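(* Let $d\in\{2,3\}$, $0<n_i<1$, $C_{\Re}\ge2$, let $C_{\Im},k_0$ be as in the context, let $k\ge k_0$, and let $\widehat L\in (H^1(B_2))^*$ be given. Then the parametric mapping $$\mathbf z\in\ell^\infty(\mathbb N,\mathbb C)\mapsto\breve u(\mathbf z;\cdot):=\widehat u(\mathfrak r(\mathbf z);\cdot)\in H^1(B_2)$$ is holomorphic on $$\mathcal H(C_{\Re},C_{\Im},k):=\Big\{(\zeta_j)_{j\in\mathbb N}\in\ell^\infty(\mathbb N,\mathbb C):\ \sum_{j}|\beta_j||\Re\zeta_j|\le\tfrac k3,\ \ \sum_j|\beta_j||\Re\zeta_j|\,\|r_j\|_{C^1(\mathbb S^{d-1})}\le kC_{\Re},\ \ \sum_j|\beta_j||\Im\zeta_j|\,\|r_j\|_{C^1(\mathbb S^{d-1})}\le C_{\Im}\Big\},$$ where the constants $C_{\Re},C_{\Im}>0$ are independent of $k$.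
   Context: Shape parametrization: $\mathfrak r(\mathbf z;s)=\frac1k\sum_{j\ge1}\beta_jz_jr_j(s)$, $s\in\mathbb S^{d-1}$, with $k$-independent weights $\beta_j>0$, $\|(\beta_j)\|_{\ell^1}\le1\le k/3$, and real $r_j\in C^\infty(\mathbb S^{d-1})$ with $\|r_j\|_{C^0}=1$: for $d=2$, $r_j(s)=\sin(\frac j2s)$ for even $j$ and $\cos(\frac{j-1}2s)$ for odd $j$ ($s\in[0,2\pi)$); for $d=3$, $r_j$ is the real spherical harmonic $Y_{\ell,m}$, rescaled to have $C^0$-norm one, with $j=\ell^2+\ell+m+1$, $-\ell\le m\le\ell$, $\ell\in\mathbb N_0$. $B_R=\{x\in\mathbb R^d:|x|<R\}$. Fix a small $0<\lambda\ll 1$ and $\chi\in C^\infty([0,\infty))$ with $0\le\chi\le1$, $\chi(\rho)=0$ for $\rho\le\lambda$ or $\rho\ge 2-\lambda$, $|\chi'|\le 2-\lambda$, $\chi(1)=1$. $\mathfrak R:=\{\mathfrak r\in C^1(\mathbb S^{d-1},\mathbb C):\|\Re\mathfrak r\|_{C^0}\le\frac13\}$; $\Phi(\mathfrak r;\rho s)=s(\rho+\chi(\rho)\mathfrak r(s))$ with Jacobian $D\Phi$; $\widehat A=\det(D\Phi)D\Phi^{-1}D\Phi^{-\top}$ (plain transpose); $\widehat n=\det(D\Phi)n_0$, $n_0=n_i$ for $|\widehat x|<1$, $n_0=1$ for $|\widehat x|\ge1$. $\mathrm{DtN}\,g=k^{-1}\partial_{|x|}v$ on $\partial B_2$, where $v$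 solves $(-k^{-2}\Delta-1)v=0$ outside $\overline{B_2}$, $v=g$ on $\partial B_2$, and $|x|^{(d-1)/2}(k^{-1}\partial_{|x|}-\mathrm i)v\to0$ uniformly as $|x|\to\infty$. $\widehat a(\mathfrak r;\widehat u,\widehat v)=\int_{B_2}(k^{-2}\widehat A\nabla\widehat u\cdot\overline{\nabla\widehat v}-\widehat n\,\widehat u\,\overline{\widehat v})-\int_{\partial B_2}k^{-1}\mathrm{DtN}(\widehat u)\overline{\widehat v}\,dS$. $\widehat u(\mathfrak r;\cdot)\in H^1(B_2)$ is the solution of $\widehat a(\mathfrak r;\widehat u,\widehat v)=\widehat L(\widehat v)$ for all $\widehat v\in H^1(B_2)$. Constants: $C_{\Im}>0$, $k_0\ge\frac12$ (depending only on $d,n_i,C_{\Re}$; in particular independent of $k$) are such that for all $k\ge k_0$ and every $\widehat L\in(H^1(B_2))^*$ the map $\mathfrak r\in C^1(\mathbb S^{d-1},\mathbb C)\mapsto\widehat u(\mathfrak r)\in H^1(B_2)$ is analytic on $\mathcal A(k;C_{\Re},C_{\Im})=\{\mathfrak r\in\mathfrak R:\|\Re\mathfrak r\|_{C^1}\le C_{\Re},\ k\|\Im\mathfrak r\|_{C^1}\le C_{\Im}\}$. Such constants exist.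
   Formalization: Holomorphy in the sup norm is stated when r(z) is C^1 for all z in ℓ^∞ (for β only in ℓ^1, e.g. d=2, β_j=c/j^2, it need not be); in general it is stated on {z in ℓ^∞: r(z) in C^1} with norm ||z||_∞+||r(z)||_{C^1}. *)

theory Defs
  imports
    "HOL-Analysis.Analysis"
    "HOL-Computational_Algebra.Polynomial"
    "HOL-Library.Function_Algebras"
begin

section \<open>Holomorphic maps between spaces of complex-valued functions\<close>

text \<open>
  All spaces below are given by a carrier, a set of complex-valued functions closed under the
  pointwise operations, and a (semi)norm.  A function of seminorm zero represents the zero
  element (for $H^1$: it vanishes almost everywhere; for functions on the sphere: it vanishes on
  the sphere), so identities in the target are required up to seminorm zero.
\<close>

definition norm_open ::
  "('a \<Rightarrow> complex) set \<Rightarrow> (('a \<Rightarrow> complex) \<Rightarrow> real) \<Rightarrow> ('a \<Rightarrow> complex) set \<Rightarrow> bool" where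
  "norm_open X nX U \<longleftrightarrow> U \<subseteq> X \<and> (\<forall>x\<in>U. \<exists>\<epsilon>>0. \<forall>h\<in>X. nX h < \<epsilon> \<longrightarrow> x + h \<in> U)"

definition complex_bounded_linear ::
  "('a \<Rightarrow> complex) set \<Rightarrow> (('a \<Rightarrow> complex) \<Rightarrow> real) \<Rightarrow> ('b \<Rightarrow> complex) set \<Rightarrow>
   (('b \<Rightarrow> complex) \<Rightarrow> real) \<Rightarrow> (('a \<Rightarrow> complex) \<Rightarrow> 'b \<Rightarrow> complex) \<Rightarrow> bool" where
  "complex_bounded_linear X nX Y nY T \<longleftrightarrow>
     (\<forall>h\<in>X. T h \<in> Y) \<and>
     (\<forall>g\<in>X. \<forall>h\<in>X. nY (T (g + h) - (T g + T h)) = 0) \<and>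
     (\<forall>c. \<forall>h\<in>X. nY (T (\<lambda>s. c * h s) - (\<lambda>t. c * T h t)) = 0) \<and>
     (\<exists>B. \<forall>h\<in>X. nY (T h) \<le> B * nX h)"

definition complex_frechet_differentiable ::
  "('a \<Rightarrow> complex) set \<Rightarrow> (('a \<Rightarrow> complex) \<Rightarrow> real) \<Rightarrow> ('b \<Rightarrow> complex) set \<Rightarrow>
   (('b \<Rightarrow> complex) \<Rightarrow> real) \<Rightarrow> (('a \<Rightarrow> complex) \<Rightarrow> 'b \<Rightarrow> complex) \<Rightarrow> ('a \<Rightarrow> complex) \<Rightarrow> bool" where
  "complex_frechet_differentiable X nX Y nY f x \<longleftrightarrow>
     (\<exists>T. complex_bounded_linear X nX Y nY T \<and>
        (\<forall>\<epsilon>>0. \<exists>\<delta>>0. \<forall>h\<in>X. nX h < \<delta> \<longrightarrow> nY (f (x + h) - f x - T h) \<le> \<epsilon> * nX h))"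

text \<open>
  As for \<^const>\<open>analytic_on\<close>, holomorphy (equivalently, analyticity) on a set that need not be
  open is holomorphy on an open neighbourhood of it.  The set \<open>D\<close> is where \<open>f\<close> is properly
  defined.
\<close>

definition holomorphic_near ::
  "('a \<Rightarrow> complex) set \<Rightarrow> (('a \<Rightarrow> complex) \<Rightarrow> real) \<Rightarrow> ('b \<Rightarrow> complex) set \<Rightarrow>
   (('b \<Rightarrow> complex) \<Rightarrow> real) \<Rightarrow> ('a \<Rightarrow> complex) set \<Rightarrow> (('a \<Rightarrow> complex) \<Rightarrow> 'b \<Rightarrow> complex) \<Rightarrow>
   ('a \<Rightarrow> complex) set \<Rightarrow> bool" where
  "holomorphic_near X nX Y nY D f S \<longleftrightarrow>
     (\<exists>U. norm_open X nX U \<and> S \<subseteq> U \<and> U \<subseteq> D \<and>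
        (\<forall>x\<in>U. f x \<in> Y \<and> complex_frechet_differentiable X nX Y nY f x))"


section \<open>Differentiability classes\<close>

primrec Ck_on ::
  "nat \<Rightarrow> 'a::real_normed_vector set \<Rightarrow> ('a \<Rightarrow> 'b::real_normed_vector) \<Rightarrow> bool" where
  "Ck_on 0 S f \<longleftrightarrow> continuous_on S f"
| "Ck_on (Suc m) S f \<longleftrightarrow>
     (\<forall>x\<in>S. f differentiable (at x)) \<and> (\<forall>v. Ck_on m S (\<lambda>x. frechet_derivative f (at x) v))"

definition smooth_on ::
  "'a::real_normed_vector set \<Rightarrow> ('a \<Rightarrow> 'b::real_normed_vector) \<Rightarrow> bool" where
  "smooth_on S f \<longleftrightarrow> (\<forall>m. Ck_on m S f)"

definition pd :: "'n \<Rightarrow> (real^'n \<Rightarrow> 'b::real_normed_vector) \<Rightarrow> real^'n \<Rightarrow> 'b" where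
  "pd i f x = frechet_derivative f (at x) (axis i 1)"

definition radial_deriv :: "(real^'n \<Rightarrow> 'b::real_normed_vector) \<Rightarrow> real^'n \<Rightarrow> 'b" where
  "radial_deriv f x = frechet_derivative f (at x) (x /\<^sub>R norm x)"


section \<open>$C^1$ functions on the unit sphere\<close>

text \<open>
  A function on the sphere is represented by a function on the whole space of which only the
  values on the sphere matter.  Its surface gradient at \<open>s\<close> is the gradient at \<open>s\<close> of its
  extension that is constant along rays.
\<close>

definition ray_ext :: "(real^'n \<Rightarrow> 'b) \<Rightarrow> real^'n \<Rightarrow> 'b" where
  "ray_ext r x = r (x /\<^sub>R norm x)"

definition surf_grad :: "(real^'n \<Rightarrow> 'b::real_normed_vector) \<Rightarrow> real^'n \<Rightarrow> 'b^'n" where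
  "surf_grad r s = (\<chi> i. pd i (ray_ext r) s)"

definition C1_sphere :: "(real^'n \<Rightarrow> complex) set" where
  "C1_sphere = {r. Ck_on 1 (- {0}) (ray_ext r)}"

definition C0_norm :: "(real^'n \<Rightarrow> 'b::real_normed_vector) \<Rightarrow> real" where
  "C0_norm r = (SUP s\<in>sphere 0 1. norm (r s))"

definition C1_norm :: "(real^'n \<Rightarrow> 'b::real_normed_vector) \<Rightarrow> real" where
  "C1_norm r = C0_norm r + C0_norm (surf_grad r)"

definition analyticity_set :: "real \<Rightarrow> real \<Rightarrow> real \<Rightarrow> (real^'n \<Rightarrow> complex) set" where
  "analyticity_set k C_Re C_Im =
     {r \<in> C1_sphere. C0_norm (\<lambda>s. Re (r s)) \<le> 1/3 \<and>
        C1_norm (\<lambda>s. Re (r s)) \<le> C_Re \<and> k * C1_norm (\<lambda>s. Im (r s)) \<le> C_Im}"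


section \<open>The shape parametrization\<close>

text \<open>
  The labelling \<open>e\<close> of the index type lists the Cartesian coordinates as \<open>e 1, \<dots>, e d\<close>.
\<close>

definition azimuth :: "(nat \<Rightarrow> 'n) \<Rightarrow> real^'n \<Rightarrow> real" where
  "azimuth e s = Arg2pi (Complex (s $ e 1) (s $ e 2))"

definition circle_fun :: "(nat \<Rightarrow> 'n) \<Rightarrow> nat \<Rightarrow> real^'n \<Rightarrow> real" where
  "circle_fun e j s =
     (if even j then sin (real j / 2 * azimuth e s) else cos ((real j - 1) / 2 * azimuth e s))"

text \<open>Rodrigues' formula; associated Legendre functions without the Condon--Shortley sign.\<close>

definition legendre :: "nat \<Rightarrow> real poly" where
  "legendre l = smult (1 / (2 ^ l * fact l)) ((pderiv ^^ l) ([:-1, 0, 1:] ^ l))"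

definition assoc_legendre :: "nat \<Rightarrow> nat \<Rightarrow> real \<Rightarrow> real" where
  "assoc_legendre l m t = sqrt (1 - t\<^sup>2) ^ m * poly ((pderiv ^^ m) (legendre l)) t"

text \<open>Here \<open>s $ e 3\<close> is the cosine of the polar angle.\<close>

definition real_sph_harm :: "(nat \<Rightarrow> 'n) \<Rightarrow> nat \<Rightarrow> int \<Rightarrow> real^'n \<Rightarrow> real" where
  "real_sph_harm e l m s =
     (let q = nat \<bar>m\<bar> in
      sqrt ((2 * real l + 1) / (4 * pi) * (fact (l - q) / fact (l + q))) *
      assoc_legendre l q (s $ e 3) *
      (if m = 0 then 1
       else if m > 0 then sqrt 2 * cos (real q * azimuth e s)
       else sqrt 2 * sin (real q * azimuth e s)))"

text \<open>
  For \<open>j \<ge> 1\<close> the equation $j = \ell^2 + \ell + m + 1$ with $-\ell \le m \le \ell$ is solved by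
  $\ell = \lfloor\sqrt{j-1}\rfloor$.
\<close>

definition sphere_fun :: "(nat \<Rightarrow> 'n) \<Rightarrow> nat \<Rightarrow> real^'n \<Rightarrow> real" where
  "sphere_fun e j =
     (let l = nat \<lfloor>sqrt (real j - 1)\<rfloor>;
          Y = real_sph_harm e l (int j - 1 - (int l)\<^sup>2 - int l)
      in (\<lambda>s. Y s / C0_norm Y))"

definition shape_fun :: "(nat \<Rightarrow> 'n::finite) \<Rightarrow> nat \<Rightarrow> real^'n \<Rightarrow> real" where
  "shape_fun e j = (if CARD('n) = 2 then circle_fun e j else sphere_fun e j)"

text \<open>Sequences are indexed from 0: entry \<open>i\<close> belongs to the mode $j = i + 1$.\<close>

definition shape ::
  "(nat \<Rightarrow> 'n::finite) \<Rightarrow> (nat \<Rightarrow> real) \<Rightarrow> real \<Rightarrow> (nat \<Rightarrow> complex) \<Rightarrow> real^'n \<Rightarrow> complex" where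
  "shape e \<beta> k z s =
     (if norm s = 1
      then (1 / of_real k) * (\<Sum>i. of_real (\<beta> i) * z i * of_real (shape_fun e (Suc i) s))
      else 0)"

definition linf :: "(nat \<Rightarrow> complex) set" where
  "linf = {z. bounded (range z)}"

definition linf_norm :: "(nat \<Rightarrow> complex) \<Rightarrow> real" where
  "linf_norm z = (SUP i. norm (z i))"

definition param_set ::
  "(nat \<Rightarrow> 'n::finite) \<Rightarrow> (nat \<Rightarrow> real) \<Rightarrow> real \<Rightarrow> real \<Rightarrow> real \<Rightarrow> (nat \<Rightarrow> complex) set" where
  "param_set e \<beta> C_Re C_Im k =
     {\<zeta> \<in> linf.
        (\<Sum>i. ennreal (\<bar>\<beta> i\<bar> * \<bar>Re (\<zeta> i)\<bar>)) \<le> ennreal (k / 3) \<and>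
        (\<Sum>i. ennreal (\<bar>\<beta> i\<bar> * \<bar>Re (\<zeta> i)\<bar> * C1_norm (shape_fun e (Suc i)))) \<le> ennreal (k * C_Re) \<and>
        (\<Sum>i. ennreal (\<bar>\<beta> i\<bar> * \<bar>Im (\<zeta> i)\<bar> * C1_norm (shape_fun e (Suc i)))) \<le> ennreal C_Im}"

text \<open>
  The sequences whose shape function is $C^1$, with the graph norm.  For $\beta \in \ell^1$ this
  can be a proper subspace of $\ell^\infty$; then no point of it has an $\ell^\infty$
  neighbourhood on which all shape functions are $C^1$, and \<open>z \<mapsto> shape e \<beta> k z\<close> is not
  continuous from the supremum norm to the $C^1$ norm.  If it is all of $\ell^\infty$, the graph
  norm is equivalent to the supremum norm.
\<close>

definition shape_dom :: "(nat \<Rightarrow> 'n::finite) \<Rightarrow> (nat \<Rightarrow> real) \<Rightarrow> real \<Rightarrow> (nat \<Rightarrow> complex) set" where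
  "shape_dom e \<beta> k = {z \<in> linf. shape e \<beta> k z \<in> C1_sphere}"

definition shape_norm ::
  "(nat \<Rightarrow> 'n::finite) \<Rightarrow> (nat \<Rightarrow> real) \<Rightarrow> real \<Rightarrow> (nat \<Rightarrow> complex) \<Rightarrow> real" where
  "shape_norm e \<beta> k z = linf_norm z + C1_norm (shape e \<beta> k z)"


section \<open>Sobolev spaces\<close>

definition L2 :: "(real^'n::finite) set \<Rightarrow> (real^'n \<Rightarrow> 'b::real_normed_vector) \<Rightarrow> bool" where
  "L2 \<Omega> f \<longleftrightarrow> f \<in> borel_measurable (lebesgue_on \<Omega>) \<and>
     integrable (lebesgue_on \<Omega>) (\<lambda>x. (norm (f x))\<^sup>2)"

definition test_function :: "(real^'n::finite) set \<Rightarrow> (real^'n \<Rightarrow> real) \<Rightarrow> bool" where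
  "test_function \<Omega> \<phi> \<longleftrightarrow>
     smooth_on UNIV \<phi> \<and> (\<exists>K. compact K \<and> K \<subseteq> \<Omega> \<and> (\<forall>x. x \<notin> K \<longrightarrow> \<phi> x = 0))"

definition weak_gradient ::
  "(real^'n::finite) set \<Rightarrow> (real^'n \<Rightarrow> complex) \<Rightarrow> (real^'n \<Rightarrow> complex^'n) \<Rightarrow> bool" where
  "weak_gradient \<Omega> u g \<longleftrightarrow>
     (\<forall>\<phi> i. test_function \<Omega> \<phi> \<longrightarrow>
        (LINT x|lebesgue_on \<Omega>. u x * of_real (pd i \<phi> x)) =
        - (LINT x|lebesgue_on \<Omega>. g x $ i * of_real (\<phi> x)))"

definition H1 :: "(real^'n::finite) set \<Rightarrow> (real^'n \<Rightarrow> complex) set" where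
  "H1 \<Omega> = {u. L2 \<Omega> u \<and> (\<exists>g. L2 \<Omega> g \<and> weak_gradient \<Omega> u g)}"

definition wgrad :: "(real^'n::finite) set \<Rightarrow> (real^'n \<Rightarrow> complex) \<Rightarrow> real^'n \<Rightarrow> complex^'n" where
  "wgrad \<Omega> u = (SOME g. L2 \<Omega> g \<and> weak_gradient \<Omega> u g)"

definition H1_norm :: "(real^'n::finite) set \<Rightarrow> (real^'n \<Rightarrow> complex) \<Rightarrow> real" where
  "H1_norm \<Omega> u =
     sqrt (LINT x|lebesgue_on \<Omega>. (norm (u x))\<^sup>2 + (norm (wgrad \<Omega> u x))\<^sup>2)"

text \<open>
  The dual consists of the bounded antilinear functionals, as the sesquilinear form below is
  antilinear in its second argument.
\<close>

definition H1_dual :: "(real^'n::finite) set \<Rightarrow> ((real^'n \<Rightarrow> complex) \<Rightarrow> complex) set" where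
  "H1_dual \<Omega> = {L.
     (\<forall>u\<in>H1 \<Omega>. \<forall>v\<in>H1 \<Omega>. L (u + v) = L u + L v) \<and>
     (\<forall>c. \<forall>v\<in>H1 \<Omega>. L (\<lambda>x. c * v x) = cnj c * L v) \<and>
     (\<exists>B. \<forall>v\<in>H1 \<Omega>. norm (L v) \<le> B * H1_norm \<Omega> v)}"

text \<open>
  Surface measure on the sphere of radius \<open>R\<close>: the area of a subset is \<open>d / R\<close> times the volume
  of the cone over it.
\<close>

definition surface_measure :: "real \<Rightarrow> (real^'n::finite) measure" where
  "surface_measure R = scale_measure (ennreal (real CARD('n) / R))
     (distr (lebesgue_on (ball 0 R - {0})) borel (\<lambda>x. (R / norm x) *\<^sub>R x))"

text \<open>
  The trace on $\partial B_2$ of an $H^1$ function on a domain having $\partial B_2$ as (part of)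
  its boundary: the extension by continuity of the restriction of smooth functions.
\<close>

definition has_trace ::
  "(real^'n::finite) set \<Rightarrow> (real^'n \<Rightarrow> complex) \<Rightarrow> (real^'n \<Rightarrow> complex) \<Rightarrow> bool" where
  "has_trace \<Omega> u g \<longleftrightarrow> u \<in> H1 \<Omega> \<and> g \<in> borel_measurable borel \<and>
     (\<exists>\<phi> :: nat \<Rightarrow> real^'n \<Rightarrow> complex.
        (\<forall>m. smooth_on UNIV (\<phi> m) \<and> \<phi> m - u \<in> H1 \<Omega>) \<and>
        (\<lambda>m. H1_norm \<Omega> (\<phi> m - u)) \<longlonglongrightarrow> 0 \<and>
        (\<lambda>m. \<integral>\<^sup>+ x. ennreal ((norm (\<phi> m x - g x))\<^sup>2) \<partial>surface_measure 2) \<longlonglongrightarrow> 0)"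


section \<open>The Dirichlet-to-Neumann map\<close>

definition cdot :: "complex^'n::finite \<Rightarrow> complex^'n \<Rightarrow> complex" where
  "cdot g h = (\<Sum>i\<in>UNIV. g $ i * cnj (h $ i))"

definition annulus :: "real \<Rightarrow> (real^'n::finite) set" where
  "annulus R = {x. 2 < norm x \<and> norm x < R}"

text \<open>
  \<open>v\<close> is the outgoing solution of the exterior Helmholtz problem with Dirichlet data \<open>g\<close>.
  Solutions of the Helmholtz equation are smooth in the open exterior; up to the boundary \<open>v\<close> is
  only $H^1$, so that the data is attained in the sense of traces.
\<close>

definition radiating_solution ::
  "real \<Rightarrow> (real^'n::finite \<Rightarrow> complex) \<Rightarrow> (real^'n \<Rightarrow> complex) \<Rightarrow> bool" where
  "radiating_solution k g v \<longleftrightarrow>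
     smooth_on (- cball 0 2) v \<and>
     (\<forall>x\<in>- cball 0 2. - ((\<Sum>i\<in>UNIV. pd i (pd i v) x) / of_real (k\<^sup>2)) - v x = 0) \<and>
     (\<forall>R>2. v \<in> H1 (annulus R)) \<and>
     (\<forall>R>2. has_trace (annulus R) v g) \<and>
     ((\<lambda>x. norm x powr ((real CARD('n) - 1) / 2) *\<^sub>R
        (radial_deriv v x / of_real k - \<i> * v x)) \<longlongrightarrow> 0) at_infinity"

text \<open>
  The boundary integral $\int_{\partial B_2} k^{-1}\,\mathrm{DtN}(u)\,\overline w\,dS$ with
  $\mathrm{DtN}(u) = k^{-1}\partial_{|x|} v$.  The normal derivative lies in $H^{-1/2}(\partial
  B_2)$, so the integral is the duality pairing given by Green's formula in the exterior,
  \[ \int_{\partial B_2} \partial_{|x|} v\,\overline w\,dS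
     = - \int_{|x|>2} (\nabla v\cdot\overline{\nabla W} - k^2 v\,\overline W), \]
  where \<open>W\<close> is any extension of the trace of \<open>w\<close> to the exterior with bounded support.
\<close>

definition dtn_pairing ::
  "real \<Rightarrow> (real^'n::finite \<Rightarrow> complex) \<Rightarrow> (real^'n \<Rightarrow> complex) \<Rightarrow> complex" where
  "dtn_pairing k u w = (THE c. \<exists>g h v W R.
     has_trace (ball 0 2) u g \<and> radiating_solution k g v \<and>
     has_trace (ball 0 2) w h \<and> R > 2 \<and> W \<in> H1 (- cball 0 2) \<and>
     has_trace (- cball 0 2) W h \<and> (\<forall>x. norm x \<ge> R \<longrightarrow> W x = 0) \<and>
     c = - (1 / of_real (k\<^sup>2)) * (LINT x|lebesgue_on (annulus R).
             cdot (wgrad (annulus R) v x) (wgrad (annulus R) W x) - of_real (k\<^sup>2) * v x * cnj (W x)))"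


section \<open>The transformed Helmholtz problem\<close>

text \<open>$C^\infty([0,\infty))$: restrictions of smooth functions on the line.\<close>

definition radial_cutoff :: "real \<Rightarrow> (real \<Rightarrow> real) \<Rightarrow> bool" where
  "radial_cutoff lam chi \<longleftrightarrow>
     (\<exists>g. smooth_on UNIV g \<and> (\<forall>\<rho>\<ge>0. g \<rho> = chi \<rho>)) \<and>
     (\<forall>\<rho>\<ge>0. 0 \<le> chi \<rho> \<and> chi \<rho> \<le> 1) \<and>
     (\<forall>\<rho>\<ge>0. \<rho> \<le> lam \<or> \<rho> \<ge> 2 - lam \<longrightarrow> chi \<rho> = 0) \<and>
     (\<forall>\<rho>\<ge>0. \<bar>vector_derivative chi (at \<rho> within {0..})\<bar> \<le> 2 - lam) \<and>
     chi 1 = 1"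

definition shape_map ::
  "(real \<Rightarrow> real) \<Rightarrow> (real^'n::finite \<Rightarrow> complex) \<Rightarrow> real^'n \<Rightarrow> complex^'n" where
  "shape_map chi r x = (\<chi> i. of_real ((x /\<^sub>R norm x) $ i) *
     (of_real (norm x) + of_real (chi (norm x)) * r (x /\<^sub>R norm x)))"

definition jac ::
  "(real \<Rightarrow> real) \<Rightarrow> (real^'n::finite \<Rightarrow> complex) \<Rightarrow> real^'n \<Rightarrow> complex^'n^'n" where
  "jac chi r x = (\<chi> i j. pd j (shape_map chi r) x $ i)"

definition A_hat ::
  "(real \<Rightarrow> real) \<Rightarrow> (real^'n::finite \<Rightarrow> complex) \<Rightarrow> real^'n \<Rightarrow> complex^'n^'n" where
  "A_hat chi r x = mat (det (jac chi r x)) ** matrix_inv (jac chi r x) **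
     transpose (matrix_inv (jac chi r x))"

definition n_hat ::
  "(real \<Rightarrow> real) \<Rightarrow> real \<Rightarrow> (real^'n::finite \<Rightarrow> complex) \<Rightarrow> real^'n \<Rightarrow> complex" where
  "n_hat chi n_i r x = det (jac chi r x) * of_real (if norm x < 1 then n_i else 1)"

definition a_hat ::
  "(real \<Rightarrow> real) \<Rightarrow> real \<Rightarrow> real \<Rightarrow> (real^'n::finite \<Rightarrow> complex) \<Rightarrow>
   (real^'n \<Rightarrow> complex) \<Rightarrow> (real^'n \<Rightarrow> complex) \<Rightarrow> complex" where
  "a_hat chi n_i k r u v =
     (LINT x|lebesgue_on (ball 0 2).
        cdot (A_hat chi r x *v wgrad (ball 0 2) u x) (wgrad (ball 0 2) v x) / of_real (k\<^sup>2)
        - n_hat chi n_i r x * u x * cnj (v x))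
     - dtn_pairing k u v"

definition solves ::
  "(real \<Rightarrow> real) \<Rightarrow> real \<Rightarrow> real \<Rightarrow> ((real^'n::finite \<Rightarrow> complex) \<Rightarrow> complex) \<Rightarrow>
   (real^'n \<Rightarrow> complex) \<Rightarrow> (real^'n \<Rightarrow> complex) \<Rightarrow> bool" where
  "solves chi n_i k L r u \<longleftrightarrow>
     u \<in> H1 (ball 0 2) \<and> (\<forall>v\<in>H1 (ball 0 2). a_hat chi n_i k r u v = L v)"

definition uniquely_solvable ::
  "(real \<Rightarrow> real) \<Rightarrow> real \<Rightarrow> real \<Rightarrow> ((real^'n::finite \<Rightarrow> complex) \<Rightarrow> complex) \<Rightarrow>
   (real^'n \<Rightarrow> complex) set" where
  "uniquely_solvable chi n_i k L = {r \<in> C1_sphere.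
     (\<exists>u. solves chi n_i k L r u) \<and>
     (\<forall>u u'. solves chi n_i k L r u \<longrightarrow> solves chi n_i k L r u' \<longrightarrow> H1_norm (ball 0 2) (u - u') = 0)}"

text \<open>A representative of the solution, which is unique up to null sets.\<close>

definition u_hat ::
  "(real \<Rightarrow> real) \<Rightarrow> real \<Rightarrow> real \<Rightarrow> ((real^'n::finite \<Rightarrow> complex) \<Rightarrow> complex) \<Rightarrow>
   (real^'n \<Rightarrow> complex) \<Rightarrow> real^'n \<Rightarrow> complex" where
  "u_hat chi n_i k L r = (SOME u. solves chi n_i k L r u)"

end

theory Submission
  imports Defs "HOL-Probability.Discrete_Topology"
begin

text \<open>
  The map $z \mapsto \mathfrak r(z)$ is linear and $\mathfrak r \mapsto \widehat u(\mathfrak r)$ is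
  holomorphic near the analyticity set by hypothesis, so the claim is a chain rule for a
  holomorphic map after a bounded linear one (\<open>holomorphic_near_compose_linear\<close>).  It
  applies as soon as the shape map is bounded into $C^1$ of the sphere and takes the parameter set
  into the analyticity set.
  
  The inclusion of the parameter set rests on termwise differentiation.  The three sums
  that define the parameter set control $\sum_j \beta_j |\Re z_j| \|r_j\|_{C^1}$ and
  $\sum_j \beta_j |\Im z_j| \|r_j\|_{C^1}$, so the series of the surface gradients converges
  uniformly, the real and imaginary parts of the shape function are $C^1$, and their norms obey the
  triangle inequality for infinitely many summands (\<open>C1_on_sphere_series\<close>).  This needs
  every $r_j$ to be $C^1$ although it is written with an angle that jumps: on the sphere it is a
  polynomial in the coordinates, because $\rho^q \cos(q\varphi)$ and $\rho^q \sin(q\varphi)$ are the real and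
  imaginary part of $(s_1 + i s_2)^q$.
  
  Boundedness is immediate for the graph norm.  For the supremum norm it has to be extracted
  from the mere fact that all shape functions are $C^1$, and this is the uniform boundedness
  principle: the difference quotients of the shape function, at all points of the sphere and in all
  coordinate directions, are bounded functionals on $\ell^\infty$ that are bounded
  pointwise, hence uniformly, and their limits are the components of the surface gradient
  (\<open>C1_norm_shape_bounded\<close>).
\<close>

section \<open>Composition with a bounded linear map\<close>

text \<open>
  The neighbourhood is the preimage of the one for \<open>f\<close>, and the derivative at \<open>x\<close> is the
  derivative of \<open>f\<close> at \<open>P x\<close> after \<open>P\<close>.
\<close>
lemma holomorphic_near_compose_linear:
  assumes hol: "holomorphic_near Z nZ Y nY D f S"
    and X_add: "\<And>g h. g \<in> X \<Longrightarrow> h \<in> X \<Longrightarrow> g + h \<in> X"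
    and P_in: "\<And>h. h \<in> X \<Longrightarrow> P h \<in> Z"
    and P_add: "\<And>g h. g \<in> X \<Longrightarrow> h \<in> X \<Longrightarrow> P (g + h) = P g + P h"
    and P_scale: "\<And>c h. h \<in> X \<Longrightarrow> P (\<lambda>s. c * h s) = (\<lambda>t. c * P h t)"
    and nZ_nonneg: "\<And>z. z \<in> Z \<Longrightarrow> 0 \<le> nZ z"
    and "M > 0" and P_bound: "\<And>h. h \<in> X \<Longrightarrow> nZ (P h) \<le> M * nX h"
    and R: "R \<subseteq> X" "P ` R \<subseteq> S"
  shows "holomorphic_near X nX Y nY {x. P x \<in> D} (\<lambda>x. f (P x)) R"
proof -
  obtain U where U: "norm_open Z nZ U" "S \<subseteq> U" "U \<subseteq> D"
    and fU: "\<And>z. z \<in> U \<Longrightarrow> f z \<in> Y \<and> complex_frechet_differentiable Z nZ Y nY f z"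
    using hol unfolding holomorphic_near_def by blast
  define V where "V = {x \<in> X. P x \<in> U}"
  have "norm_open X nX V"
    unfolding norm_open_def
  proof (intro conjI ballI)
    show "V \<subseteq> X" by (auto simp: V_def)
  next
    fix x assume x: "x \<in> V"
    then obtain \<epsilon> where \<epsilon>: "\<epsilon> > 0" "\<And>h. h \<in> Z \<Longrightarrow> nZ h < \<epsilon> \<Longrightarrow> P x + h \<in> U"
      using U(1) unfolding norm_open_def V_def by blast
    have "x + h \<in> V" if h: "h \<in> X" "nX h < \<epsilon> / M" for h
    proof -
      have "M * nX h < \<epsilon>"
        using h(2) \<open>M > 0\<close> by (simp add: field_simps)
      then have "P x + P h \<in> U"
        using \<epsilon>(2)[of "P h"] P_bound[of h] P_in h(1) by auto
      then show ?thesis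
        using x h(1) P_add[of x h] X_add[of x h] by (auto simp: V_def)
    qed
    then show "\<exists>\<epsilon>>0. \<forall>h\<in>X. nX h < \<epsilon> \<longrightarrow> x + h \<in> V"
      using \<epsilon>(1) \<open>M > 0\<close> by (intro exI[of _ "\<epsilon> / M"]) auto
  qed
  moreover have "R \<subseteq> V" "V \<subseteq> {x. P x \<in> D}"
    using R U by (auto simp: V_def)
  moreover have "f (P x) \<in> Y \<and> complex_frechet_differentiable X nX Y nY (\<lambda>x. f (P x)) x"
    if x: "x \<in> V" for x
  proof
    have xX: "x \<in> X" and "P x \<in> U"
      using x by (auto simp: V_def)
    then show "f (P x) \<in> Y"
      using fU by blast
    obtain T where T: "complex_bounded_linear Z nZ Y nY T"
      and T_diff: "\<And>\<epsilon>. \<epsilon> > 0 \<Longrightarrow>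
        \<exists>\<delta>>0. \<forall>h\<in>Z. nZ h < \<delta> \<longrightarrow> nY (f (P x + h) - f (P x) - T h) \<le> \<epsilon> * nZ h"
      using fU[OF \<open>P x \<in> U\<close>] unfolding complex_frechet_differentiable_def by blast
    have "complex_bounded_linear X nX Y nY (\<lambda>h. T (P h))"
    proof -
      obtain B where B: "\<And>h. h \<in> Z \<Longrightarrow> nY (T h) \<le> B * nZ h"
        using T unfolding complex_bounded_linear_def by blast
      have "nY (T (P h)) \<le> (\<bar>B\<bar> * M) * nX h" if h: "h \<in> X" for h
      proof -
        have "nY (T (P h)) \<le> B * nZ (P h)"
          using B P_in h by blast
        also have "\<dots> \<le> \<bar>B\<bar> * nZ (P h)"
          using nZ_nonneg P_in h by (intro mult_right_mono) auto
        also have "\<dots> \<le> \<bar>B\<bar> * (M * nX h)"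
          using P_bound h by (intro mult_left_mono) auto
        finally show ?thesis by (simp add: mult.assoc)
      qed
      then show ?thesis
        using T P_in P_add P_scale unfolding complex_bounded_linear_def by auto
    qed
    moreover have "\<exists>\<delta>>0. \<forall>h\<in>X. nX h < \<delta> \<longrightarrow>
        nY (f (P (x + h)) - f (P x) - T (P h)) \<le> \<epsilon> * nX h" if "\<epsilon> > 0" for \<epsilon>
    proof -
      have "\<epsilon> / M > 0"
        using that \<open>M > 0\<close> by simp
      then obtain \<delta> where \<delta>: "\<delta> > 0" "\<And>h. h \<in> Z \<Longrightarrow> nZ h < \<delta> \<Longrightarrow>
          nY (f (P x + h) - f (P x) - T h) \<le> \<epsilon> / M * nZ h"
        using T_diff by blast
      have "nY (f (P (x + h)) - f (P x) - T (P h)) \<le> \<epsilon> * nX h"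
        if h: "h \<in> X" "nX h < \<delta> / M" for h
      proof -
        have "M * nX h < \<delta>"
          using h(2) \<open>M > 0\<close> by (simp add: field_simps)
        then have "nY (f (P x + P h) - f (P x) - T (P h)) \<le> \<epsilon> / M * nZ (P h)"
          using \<delta>(2) P_in P_bound[of h] h(1) by auto
        also have "\<dots> \<le> \<epsilon> / M * (M * nX h)"
          using P_bound h(1) \<open>\<epsilon> / M > 0\<close> by (intro mult_left_mono) auto
        finally show ?thesis
          using P_add xX h(1) \<open>M > 0\<close> by simp
      qed
      then show ?thesis
        using \<delta>(1) \<open>M > 0\<close> by (intro exI[of _ "\<delta> / M"]) auto
    qed
    ultimately show "complex_frechet_differentiable X nX Y nY (\<lambda>x. f (P x)) x"
      unfolding complex_frechet_differentiable_def by blast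
  qed
  ultimately show ?thesis
    unfolding holomorphic_near_def by blast
qed

section \<open>The uniform boundedness principle\<close>

text \<open>
  By Baire's theorem one of the closed sets on which all \<open>T i\<close> are bounded by \<open>n\<close> contains a
  ball; differences of its points bound all \<open>T i\<close> on a ball around zero.
\<close>
lemma uniform_boundedness:
  fixes T :: "'i \<Rightarrow> 'a::{real_normed_vector, complete_space} \<Rightarrow> 'b::real_normed_vector"
  assumes lin: "\<And>i. i \<in> I \<Longrightarrow> bounded_linear (T i)"
    and ptw: "\<And>x. \<exists>B. \<forall>i\<in>I. norm (T i x) \<le> B"
  obtains M where "M > 0" "\<And>i x. i \<in> I \<Longrightarrow> norm (T i x) \<le> M * norm x"
proof -
  define C where "C n = (\<Inter>i\<in>I. {x. norm (T i x) \<le> real n})" for n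
  have "closed (C n)" for n
    unfolding C_def
    by (intro closed_INT ballI closed_Collect_le continuous_intros linear_continuous_on lin)
  moreover have "(\<Union>n. C n) = UNIV"
  proof -
    have "\<exists>n. x \<in> C n" for x
    proof -
      obtain B where B: "\<And>i. i \<in> I \<Longrightarrow> norm (T i x) \<le> B"
        using ptw by blast
      obtain n where "B \<le> real n"
        using real_arch_simple by blast
      then have "x \<in> C n"
        using B unfolding C_def by force
      then show ?thesis ..
    qed
    then show ?thesis by blast
  qed
  ultimately obtain n where "interior (C n) \<noteq> {}"
    using Baire_category_alt[of "euclidean :: 'a topology" "range C"] completely_metrizable_space_euclidean
    by (auto simp: euclidean_interior_of)
  then obtain z e where e: "e > 0" "cball z e \<subseteq> C n"
    using mem_interior_cball by blast
  have bound: "norm (T i x) \<le> (2 * real n / e + 1) * norm x" if i: "i \<in> I" for i x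
  proof (cases "x = 0")
    case True
    then show ?thesis
      using linear_0[OF bounded_linear.linear[OF lin[OF i]]] by simp
  next
    case False
    define y where "y = (e / norm x) *\<^sub>R x"
    have "z \<in> cball z e" "z + y \<in> cball z e"
      using False e(1) by (auto simp: y_def dist_norm)
    then have "norm (T i z) \<le> n" "norm (T i (z + y)) \<le> n"
      using e(2) i unfolding C_def by blast+
    moreover have "T i y = T i (z + y) - T i z"
      using linear_add[OF bounded_linear.linear[OF lin[OF i]]] by simp
    ultimately have "norm (T i y) \<le> 2 * real n"
      using norm_triangle_ineq4[of "T i (z + y)" "T i z"] by simp
    moreover have "T i y = (e / norm x) *\<^sub>R T i x"
      unfolding y_def using linear_cmul[OF bounded_linear.linear[OF lin[OF i]]] .
    ultimately have "e / norm x * norm (T i x) \<le> 2 * real n"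
      using e(1) by simp
    then have "norm (T i x) \<le> 2 * real n / e * norm x"
      using e(1) False by (simp add: field_simps)
    then show ?thesis
      unfolding distrib_right using norm_ge_zero[of x] by linarith
  qed
  have "2 * real n / e + 1 > 0"
    using e(1) by (simp add: add_nonneg_pos)
  from that[OF this bound] show ?thesis .
qed

section \<open>$C^1$ functions on the sphere\<close>

lemma Ck_on_1_iff:
  "Ck_on 1 S f \<longleftrightarrow>
     (\<exists>f'. (\<forall>x\<in>S. (f has_derivative f' x) (at x)) \<and> (\<forall>v. continuous_on S (\<lambda>x. f' x v)))"
proof
  assume "Ck_on 1 S f"
  then show "\<exists>f'. (\<forall>x\<in>S. (f has_derivative f' x) (at x)) \<and> (\<forall>v. continuous_on S (\<lambda>x. f' x v))"
    by (intro exI[of _ "\<lambda>x. frechet_derivative f (at x)"]) (auto simp: frechet_derivative_works)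
next
  assume "\<exists>f'. (\<forall>x\<in>S. (f has_derivative f' x) (at x)) \<and> (\<forall>v. continuous_on S (\<lambda>x. f' x v))"
  then obtain f' where f': "\<And>x. x \<in> S \<Longrightarrow> (f has_derivative f' x) (at x)"
    and cont: "\<And>v. continuous_on S (\<lambda>x. f' x v)"
    by blast
  have "continuous_on S (\<lambda>x. frechet_derivative f (at x) v)" for v
    using cont[of v] by (subst continuous_on_cong[OF refl]) (simp_all flip: frechet_derivative_at[OF f'])
  then show "Ck_on 1 S f"
    using f' by (auto simp: differentiable_def)
qed

text \<open>
  The carrier \<open>C1_sphere\<close> for functions with values in any normed space: the modes and the real and
  imaginary parts of shape functions are real-valued.
\<close>
definition C1_on_sphere :: "(real^'n::finite \<Rightarrow> 'b::real_normed_vector) \<Rightarrow> bool" where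
  "C1_on_sphere r \<longleftrightarrow> Ck_on 1 (- {0}) (ray_ext r)"

lemma C1_sphere_eq: "C1_sphere = Collect C1_on_sphere"
  unfolding C1_sphere_def C1_on_sphere_def by (rule refl)

lemma C1_on_sphereI:
  assumes "\<And>x. x \<noteq> 0 \<Longrightarrow> (ray_ext r has_derivative f' x) (at x)"
    and "\<And>v. continuous_on (- {0}) (\<lambda>x. f' x v)"
  shows "C1_on_sphere r"
  using assms unfolding C1_on_sphere_def Ck_on_1_iff by auto

lemma C1_on_sphereE:
  assumes "C1_on_sphere r"
  obtains f' where "\<And>x. x \<noteq> 0 \<Longrightarrow> (ray_ext r has_derivative f' x) (at x)"
    and "\<And>v. continuous_on (- {0}) (\<lambda>x. f' x v)"
  using assms unfolding C1_on_sphere_def Ck_on_1_iff by auto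

lemma ray_ext_eq_on_sphere:
  assumes "\<And>s. norm s = 1 \<Longrightarrow> r s = r' s" and "x \<noteq> 0"
  shows "ray_ext r x = ray_ext r' x"
  using assms by (simp add: ray_ext_def)

lemma ray_ext_on_sphere: "norm s = 1 \<Longrightarrow> ray_ext r s = r s"
  by (simp add: ray_ext_def)

lemma has_derivative_ray_ext_cong:
  assumes "\<And>s. norm s = 1 \<Longrightarrow> r s = r' s" and "x \<noteq> 0"
  shows "(ray_ext r has_derivative D) (at x) \<longleftrightarrow> (ray_ext r' has_derivative D) (at x)"
proof -
  have eq: "ray_ext r y = ray_ext r' y" if "y \<in> - {0}" for y
    using ray_ext_eq_on_sphere[of r r', OF assms(1)] that by simp
  have x: "x \<in> - {0}"
    using assms(2) by simp
  show ?thesis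
    using has_derivative_transform_within_open[OF _ _ x, of "ray_ext r" D UNIV "ray_ext r'"]
      has_derivative_transform_within_open[OF _ _ x, of "ray_ext r'" D UNIV "ray_ext r"] eq
    by (metis open_delete open_UNIV Compl_eq_Diff_UNIV)
qed

lemma C1_on_sphere_cong:
  assumes "\<And>s. norm s = 1 \<Longrightarrow> r s = r' s"
  shows "C1_on_sphere r \<longleftrightarrow> C1_on_sphere r'"
  using has_derivative_ray_ext_cong[of r r', OF assms]
  unfolding C1_on_sphere_def Ck_on_1_iff by auto

lemma has_derivative_ray_ext:
  assumes "C1_on_sphere r" and "x \<noteq> 0"
  shows "(ray_ext r has_derivative frechet_derivative (ray_ext r) (at x)) (at x)"
  using assms by (simp add: C1_on_sphere_def frechet_derivative_works)

lemma has_derivative_ray_ext_coords: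
  fixes r :: "real^'n::finite \<Rightarrow> 'b::real_normed_vector"
  assumes "C1_on_sphere r" and "x \<noteq> 0"
  shows "(ray_ext r has_derivative (\<lambda>h. \<Sum>i\<in>UNIV. h $ i *\<^sub>R surf_grad r x $ i)) (at x)"
proof -
  define D where "D = frechet_derivative (ray_ext r) (at x)"
  have D: "(ray_ext r has_derivative D) (at x)"
    using has_derivative_ray_ext[OF assms] by (simp add: D_def)
  then have "linear D"
    by (rule has_derivative_linear)
  have "D h = (\<Sum>i\<in>UNIV. h $ i *\<^sub>R surf_grad r x $ i)" for h
  proof -
    have "D h = D (\<Sum>i\<in>UNIV. h $ i *\<^sub>R axis i 1)"
      using basis_expansion[of h] by (simp add: scalar_mult_eq_scaleR)
    also have "\<dots> = (\<Sum>i\<in>UNIV. h $ i *\<^sub>R D (axis i 1))"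
      using \<open>linear D\<close> by (simp add: linear_sum linear_cmul)
    finally show ?thesis
      by (simp add: surf_grad_def pd_def D_def)
  qed
  then have "D = (\<lambda>h. \<Sum>i\<in>UNIV. h $ i *\<^sub>R surf_grad r x $ i)"
    by (rule ext)
  with D show ?thesis by simp
qed

lemma surf_grad_eqI:
  assumes "(ray_ext r has_derivative D) (at x)"
  shows "surf_grad r x = (\<chi> i. D (axis i 1))"
  using frechet_derivative_at[OF assms] by (simp add: surf_grad_def pd_def)

lemma continuous_on_sphere_if_C1:
  assumes "C1_on_sphere r"
  shows "continuous_on (sphere 0 1) r"
proof -
  have "continuous_on (sphere 0 1) (ray_ext r)"
    by (intro continuous_at_imp_continuous_on ballI
        has_derivative_continuous[OF has_derivative_ray_ext[OF assms]]) auto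
  then show ?thesis
    by (subst continuous_on_cong[OF refl]) (auto simp: ray_ext_on_sphere)
qed

lemma continuous_on_surf_grad:
  assumes "C1_on_sphere r"
  shows "continuous_on (- {0}) (surf_grad r)"
  using assms unfolding surf_grad_def C1_on_sphere_def pd_def
  by (intro continuous_on_vec_lambda) auto

text \<open>
  The extension along rays is homogeneous of degree 0, so its gradient is homogeneous of degree
  $-1$.  This turns bounds on the sphere into bounds near any nonzero point.
\<close>
lemma surf_grad_homogeneous:
  assumes "C1_on_sphere r" and "x \<noteq> 0"
  shows "surf_grad r x = surf_grad r (x /\<^sub>R norm x) /\<^sub>R norm x"
proof -
  define c where "c = inverse (norm x)"
  have "c > 0" using assms(2) by (simp add: c_def)
  define D where "D = frechet_derivative (ray_ext r) (at (c *\<^sub>R x))"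
  have D: "(ray_ext r has_derivative D) (at (c *\<^sub>R x))"
    unfolding D_def using assms \<open>c > 0\<close> by (intro has_derivative_ray_ext) auto
  have "((\<lambda>y. ray_ext r (c *\<^sub>R y)) has_derivative (\<lambda>h. D (c *\<^sub>R h))) (at x)"
    by (rule has_derivative_compose[where g="ray_ext r" and f="\<lambda>y. c *\<^sub>R y"])
       (auto intro!: derivative_eq_intros D)
  moreover have "ray_ext r (c *\<^sub>R y) = ray_ext r y" for y
    using \<open>c > 0\<close> by (simp add: ray_ext_def field_simps)
  ultimately have "(ray_ext r has_derivative (\<lambda>h. D (c *\<^sub>R h))) (at x)"
    by simp
  from surf_grad_eqI[OF this] surf_grad_eqI[OF D] show ?thesis
    by (simp add: vec_eq_iff c_def linear_cmul[OF has_derivative_linear[OF D]])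
qed

subsection \<open>The $C^0$ and $C^1$ norms\<close>

text \<open>
  The supremum in \<open>C0_norm\<close> is meaningful only for bounded functions; continuity and compactness of
  the sphere provide this.
\<close>

lemma norm_le_C0_norm:
  assumes "continuous_on (sphere 0 1) r" and "norm s = 1"
  shows "norm (r s) \<le> C0_norm r"
proof -
  have "compact ((\<lambda>s. norm (r s)) ` sphere 0 1)"
    by (intro compact_continuous_image continuous_intros assms) auto
  then have "bdd_above ((\<lambda>s. norm (r s)) ` sphere 0 1)"
    by (intro bounded_imp_bdd_above compact_imp_bounded)
  then show ?thesis
    unfolding C0_norm_def using assms(2) by (intro cSUP_upper) auto
qed

lemma C0_norm_le:
  fixes r :: "real^'n::finite \<Rightarrow> 'b::real_normed_vector"
  assumes "\<And>s. norm s = 1 \<Longrightarrow> norm (r s) \<le> b"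
  shows "C0_norm r \<le> b"
proof -
  have "(axis undefined 1 :: real^'n) \<in> sphere 0 1"
    by (simp add: norm_axis_1)
  then show ?thesis
    unfolding C0_norm_def using assms by (intro cSUP_least) auto
qed

lemma C0_norm_nonneg:
  fixes r :: "real^'n::finite \<Rightarrow> 'b::real_normed_vector"
  assumes "continuous_on (sphere 0 1) r"
  shows "0 \<le> C0_norm r"
  using norm_le_C0_norm[OF assms, of "axis undefined 1"] norm_ge_zero[of "r (axis undefined 1)"]
  by (simp only: norm_axis_1) linarith

lemma continuous_on_sphere_surf_grad:
  assumes "C1_on_sphere r"
  shows "continuous_on (sphere 0 1) (surf_grad r)"
  by (rule continuous_on_subset[OF continuous_on_surf_grad[OF assms]]) auto

lemma C1_norm_nonneg: "C1_on_sphere r \<Longrightarrow> 0 \<le> C1_norm r"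
  by (simp add: C1_norm_def C0_norm_nonneg continuous_on_sphere_if_C1 continuous_on_sphere_surf_grad)

lemma norm_surf_grad_le:
  assumes "C1_on_sphere r" and "x \<noteq> 0"
  shows "norm (surf_grad r x) \<le> C1_norm r / norm x"
proof -
  have "norm (surf_grad r (x /\<^sub>R norm x)) \<le> C0_norm (surf_grad r)"
    using assms by (intro norm_le_C0_norm continuous_on_sphere_surf_grad) auto
  also have "\<dots> \<le> C1_norm r"
    using C0_norm_nonneg[OF continuous_on_sphere_if_C1[OF assms(1)]] by (simp add: C1_norm_def)
  finally show ?thesis
    using assms(2) by (subst surf_grad_homogeneous[OF assms]) (simp add: divide_right_mono field_simps)
qed

subsection \<open>Algebraic operations\<close>

lemma C1_on_sphere_const: "C1_on_sphere (\<lambda>s. c)"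
  by (rule C1_on_sphereI[where f'="\<lambda>x v. 0"]) (simp_all add: ray_ext_def [abs_def])

lemma C1_on_sphere_add:
  assumes "C1_on_sphere r" "C1_on_sphere r'"
  shows "C1_on_sphere (\<lambda>s. r s + r' s)"
proof -
  obtain f' g' where
    f: "\<And>x. x \<noteq> 0 \<Longrightarrow> (ray_ext r has_derivative f' x) (at x)" "\<And>v. continuous_on (- {0}) (\<lambda>x. f' x v)"
    and g: "\<And>x. x \<noteq> 0 \<Longrightarrow> (ray_ext r' has_derivative g' x) (at x)" "\<And>v. continuous_on (- {0}) (\<lambda>x. g' x v)"
    using C1_on_sphereE[OF assms(1)] C1_on_sphereE[OF assms(2)] by metis
  have *: "ray_ext (\<lambda>s. r s + r' s) = (\<lambda>x. ray_ext r x + ray_ext r' x)"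
    by (auto simp: ray_ext_def)
  show ?thesis
    by (rule C1_on_sphereI[where f'="\<lambda>x v. f' x v + g' x v"])
       (auto simp: * intro!: has_derivative_add continuous_on_add f g)
qed

lemma C1_on_sphere_bounded_linear:
  assumes "bounded_linear T" "C1_on_sphere r"
  shows "C1_on_sphere (\<lambda>s. T (r s))"
proof -
  obtain f' where
    f: "\<And>x. x \<noteq> 0 \<Longrightarrow> (ray_ext r has_derivative f' x) (at x)" "\<And>v. continuous_on (- {0}) (\<lambda>x. f' x v)"
    using C1_on_sphereE[OF assms(2)] by metis
  have *: "ray_ext (\<lambda>s. T (r s)) = (\<lambda>x. T (ray_ext r x))"
    by (auto simp: ray_ext_def)
  show ?thesis
    by (rule C1_on_sphereI[where f'="\<lambda>x v. T (f' x v)"])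
       (simp_all add: * f bounded_linear.has_derivative[OF assms(1)]
          bounded_linear.continuous_on[OF assms(1)])
qed

lemma C1_on_sphere_mult:
  fixes r r' :: "real^'n::finite \<Rightarrow> real"
  assumes "C1_on_sphere r" "C1_on_sphere r'"
  shows "C1_on_sphere (\<lambda>s. r s * r' s)"
proof -
  obtain f' g' where
    f: "\<And>x. x \<noteq> 0 \<Longrightarrow> (ray_ext r has_derivative f' x) (at x)" "\<And>v. continuous_on (- {0}) (\<lambda>x. f' x v)"
    and g: "\<And>x. x \<noteq> 0 \<Longrightarrow> (ray_ext r' has_derivative g' x) (at x)" "\<And>v. continuous_on (- {0}) (\<lambda>x. g' x v)"
    using C1_on_sphereE[OF assms(1)] C1_on_sphereE[OF assms(2)] by metis
  have *: "ray_ext (\<lambda>s. r s * r' s) = (\<lambda>x. ray_ext r x * ray_ext r' x)"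
    by (auto simp: ray_ext_def)
  have cont: "continuous_on (- {0}) (ray_ext r)" "continuous_on (- {0}) (ray_ext r')"
    by (intro continuous_at_imp_continuous_on ballI has_derivative_continuous[OF f(1)]
        has_derivative_continuous[OF g(1)]; simp)+
  show ?thesis
    by (rule C1_on_sphereI[where f'="\<lambda>x v. ray_ext r x * g' x v + f' x v * ray_ext r' x"])
       (simp_all add: * has_derivative_mult continuous_on_add continuous_on_mult f g cont)
qed

lemma C1_on_sphere_coord: "C1_on_sphere (\<lambda>s::real^'n::finite. s $ i)"
proof (rule C1_on_sphereI)
  fix x :: "real^'n" assume "x \<noteq> 0"
  have *: "ray_ext (\<lambda>s::real^'n. s $ i) = (\<lambda>x. inverse (norm x) * x $ i)"
    by (auto simp: ray_ext_def)
  have "((\<lambda>x::real^'n. x $ i) has_derivative (\<lambda>v. v $ i)) (at x)"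
    by (rule bounded_linear_imp_has_derivative[OF bounded_linear_vec_nth])
  moreover have "((\<lambda>x. inverse (norm x)) has_derivative
      (\<lambda>v. - (inverse (norm x) * (v \<bullet> sgn x) * inverse (norm x)))) (at x)"
    using \<open>x \<noteq> 0\<close> by (intro Deriv.has_derivative_inverse has_derivative_norm) simp_all
  ultimately show "(ray_ext (\<lambda>s. s $ i) has_derivative
      (\<lambda>v. inverse (norm x) * v $ i + - (inverse (norm x) * (v \<bullet> sgn x) * inverse (norm x)) * x $ i)) (at x)"
    unfolding * by (rule has_derivative_mult[rotated])
next
  fix v :: "real^'n"
  have "continuous_on (- {0}) (\<lambda>x::real^'n. inverse (norm x))" "continuous_on (- {0}) (\<lambda>x::real^'n. sgn x)"
    by (auto intro!: continuous_on_inverse continuous_on_sgn continuous_on_norm continuous_on_id)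
  then show "continuous_on (- {0}) (\<lambda>x. inverse (norm x) * v $ i
      + - (inverse (norm x) * (v \<bullet> sgn x) * inverse (norm x)) * x $ i)"
    by (intro continuous_on_add continuous_on_mult continuous_on_minus continuous_on_inner
        continuous_on_const continuous_on_component continuous_on_id)
qed

section \<open>Series of $C^1$ functions\<close>

text \<open>
  On the ball around \<open>x\<close> of radius $|x|/2$ all points have norm at least $|x|/2$, so by homogeneity
  the gradients of the extended summands are dominated there by a summable sequence.  Hence the
  series may be differentiated term by term.
\<close>
lemma C1_on_sphere_series:
  fixes r :: "nat \<Rightarrow> real^'n::finite \<Rightarrow> real" and c :: "nat \<Rightarrow> real"
  assumes r: "\<And>i. C1_on_sphere (r i)"
    and summ: "summable (\<lambda>i. \<bar>c i\<bar> * C1_norm (r i))"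
    and F: "\<And>s. norm s = 1 \<Longrightarrow> (\<lambda>i. c i * r i s) sums F s"
  shows "C1_on_sphere F" and "C1_norm F \<le> (\<Sum>i. \<bar>c i\<bar> * C1_norm (r i))"
proof -
  define G where "G x = (\<Sum>i. c i *\<^sub>R surf_grad (r i) x)" for x
  have F_ext: "(\<lambda>i. c i * ray_ext (r i) x) sums ray_ext F x" if "x \<noteq> 0" for x
    using F[of "x /\<^sub>R norm x"] that by (simp add: ray_ext_def)
  have unif: "uniform_limit (ball x (norm x / 2))
      (\<lambda>n y. \<Sum>i<n. c i *\<^sub>R surf_grad (r i) y) G sequentially" if "x \<noteq> 0" for x
    unfolding G_def
  proof (rule Weierstrass_m_test)
    show "summable (\<lambda>i. \<bar>c i\<bar> * C1_norm (r i) * (2 / norm x))"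
      using summ by (rule summable_mult2)
    fix i y assume "y \<in> ball x (norm x / 2)"
    then have y: "norm x / 2 < norm y"
      using norm_triangle_ineq2[of x y] by (simp add: dist_norm)
    then have "y \<noteq> 0"
      using \<open>x \<noteq> 0\<close> by auto
    have "norm (c i *\<^sub>R surf_grad (r i) y) \<le> \<bar>c i\<bar> * (C1_norm (r i) / norm y)"
      unfolding norm_scaleR by (intro mult_left_mono norm_surf_grad_le r \<open>y \<noteq> 0\<close>) simp
    also have "\<dots> \<le> \<bar>c i\<bar> * (C1_norm (r i) / (norm x / 2))"
      using y \<open>x \<noteq> 0\<close> \<open>y \<noteq> 0\<close> C1_norm_nonneg[OF r, of i]
      by (intro mult_left_mono divide_left_mono mult_pos_pos) auto
    finally show "norm (c i *\<^sub>R surf_grad (r i) y) \<le> \<bar>c i\<bar> * C1_norm (r i) * (2 / norm x)"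
      by simp
  qed
  have G_sums: "(\<lambda>i. c i *\<^sub>R surf_grad (r i) x) sums G x" if "x \<noteq> 0" for x
    using tendsto_uniform_limitI[OF unif[OF that], of x] that by (simp add: sums_def)
  have der: "(ray_ext F has_derivative (\<lambda>h. G x \<bullet> h)) (at x)" if "x \<noteq> 0" for x
  proof -
    define B where "B = ball x (norm x / 2)"
    have "x \<in> B" "open B" "convex B"
      using that by (auto simp: B_def)
    have B: "y \<noteq> 0" if "y \<in> B" for y
      using that by (auto simp: B_def dist_norm)
    have "\<exists>g. \<forall>y\<in>B. (\<lambda>n. c n * ray_ext (r n) y) sums g y \<and> (g has_derivative (\<lambda>h. G y \<bullet> h)) (at y within B)"
    proof (rule has_derivative_series[OF \<open>convex B\<close>])
      show "x \<in> B" by fact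
      show "(\<lambda>n. c n * ray_ext (r n) x) sums ray_ext F x"
        by (rule F_ext[OF that])
      fix n y assume "y \<in> B"
      have "(ray_ext (r n) has_derivative (\<lambda>h. surf_grad (r n) y \<bullet> h)) (at y within B)"
        using has_derivative_ray_ext_coords[OF r B[OF \<open>y \<in> B\<close>], of n]
        by (auto simp: inner_vec_def mult.commute intro: has_derivative_at_withinI)
      then show "((\<lambda>y. c n * ray_ext (r n) y) has_derivative (\<lambda>h. c n * (surf_grad (r n) y \<bullet> h))) (at y within B)"
        by (rule has_derivative_mult_right)
    next
      fix e :: real assume "e > 0"
      have "\<forall>\<^sub>F n in sequentially. \<forall>y\<in>B. dist (\<Sum>i<n. c i *\<^sub>R surf_grad (r i) y) (G y) < e"
        using uniform_limitD[OF unif[OF that] \<open>e > 0\<close>] by (simp add: B_def)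
      then show "\<forall>\<^sub>F n in sequentially. \<forall>y\<in>B. \<forall>h.
          norm ((\<Sum>i<n. c i * (surf_grad (r i) y \<bullet> h)) - G y \<bullet> h) \<le> e * norm h"
      proof eventually_elim
        case (elim n)
        show ?case
        proof (intro ballI allI)
          fix y h assume "y \<in> B"
          have "(\<Sum>i<n. c i * (surf_grad (r i) y \<bullet> h)) - G y \<bullet> h
              = ((\<Sum>i<n. c i *\<^sub>R surf_grad (r i) y) - G y) \<bullet> h"
            by (simp add: inner_diff_left inner_sum_left)
          also have "norm \<dots> \<le> norm ((\<Sum>i<n. c i *\<^sub>R surf_grad (r i) y) - G y) * norm h"
            by (rule Cauchy_Schwarz_ineq2[folded real_norm_def])
          also have "\<dots> \<le> e * norm h"
            using elim \<open>y \<in> B\<close> by (intro mult_right_mono) (auto simp: dist_norm less_imp_le)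
          finally show "norm ((\<Sum>i<n. c i * (surf_grad (r i) y \<bullet> h)) - G y \<bullet> h) \<le> e * norm h" .
        qed
      qed
    qed
    then obtain g where g: "\<And>y. y \<in> B \<Longrightarrow> (\<lambda>n. c n * ray_ext (r n) y) sums g y"
      and g': "\<And>y. y \<in> B \<Longrightarrow> (g has_derivative (\<lambda>h. G y \<bullet> h)) (at y within B)"
      by blast
    have "g y = ray_ext F y" if "y \<in> B" for y
      using sums_unique2[OF g F_ext] B that by blast
    moreover have "(g has_derivative (\<lambda>h. G x \<bullet> h)) (at x)"
      using g'[OF \<open>x \<in> B\<close>] at_within_open[OF \<open>x \<in> B\<close> \<open>open B\<close>] by simp
    ultimately show ?thesis
      using has_derivative_transform_within_open \<open>x \<in> B\<close> \<open>open B\<close> by blast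
  qed
  have cont_G: "continuous_on (- {0}) G"
  proof (intro continuous_at_imp_continuous_on ballI)
    fix x :: "real^'n" assume "x \<in> - {0}"
    then have "x \<noteq> 0" by simp
    have "continuous_on (ball x (norm x / 2)) G"
    proof (rule uniform_limit_theorem[OF _ unif[OF \<open>x \<noteq> 0\<close>]])
      have "continuous_on (ball x (norm x / 2)) (surf_grad (r i))" for i
        by (rule continuous_on_subset[OF continuous_on_surf_grad[OF r]]) (auto simp: dist_norm)
      then show "\<forall>\<^sub>F n in sequentially.
          continuous_on (ball x (norm x / 2)) (\<lambda>y. \<Sum>i<n. c i *\<^sub>R surf_grad (r i) y)"
        by (auto intro!: always_eventually continuous_on_sum continuous_on_scaleR continuous_on_const)
    qed simp
    then show "isCont G x"
      using \<open>x \<noteq> 0\<close> by (simp add: continuous_on_eq_continuous_at)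
  qed
  show C1: "C1_on_sphere F"
    by (rule C1_on_sphereI[OF der]) (auto intro!: continuous_on_inner cont_G continuous_on_const)
  have grad: "surf_grad F x = G x" if "x \<noteq> 0" for x
    using surf_grad_eqI[OF der[OF that]] by (simp add: vec_eq_iff inner_axis)
  have cont: "continuous_on (sphere 0 1) (r i)" "continuous_on (sphere 0 1) (surf_grad (r i))" for i
    using continuous_on_sphere_if_C1[OF r] continuous_on_sphere_surf_grad[OF r] by auto
  have nonneg: "0 \<le> C0_norm (r i)" "0 \<le> C0_norm (surf_grad (r i))" for i
    using C0_norm_nonneg[OF cont(1)] C0_norm_nonneg[OF cont(2)] by auto
  have summ0: "summable (\<lambda>i. \<bar>c i\<bar> * C0_norm (r i))"
    and summ1: "summable (\<lambda>i. \<bar>c i\<bar> * C0_norm (surf_grad (r i)))"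
    by (rule summable_comparison_test_ev[OF _ summ];
        use nonneg in \<open>auto simp: C1_norm_def intro!: always_eventually mult_left_mono\<close>)+
  have "C0_norm F \<le> (\<Sum>i. \<bar>c i\<bar> * C0_norm (r i))"
  proof (rule C0_norm_le)
    fix s :: "real^'n" assume s: "norm s = 1"
    have *: "norm (c i * r i s) \<le> \<bar>c i\<bar> * C0_norm (r i)" for i
      using norm_le_C0_norm[OF cont(1) s, of i] by (simp add: abs_mult mult_left_mono)
    show "norm (F s) \<le> (\<Sum>i. \<bar>c i\<bar> * C0_norm (r i))"
      using norm_suminf_le[OF * summ0] sums_unique[OF F[OF s]] by simp
  qed
  moreover have "C0_norm (surf_grad F) \<le> (\<Sum>i. \<bar>c i\<bar> * C0_norm (surf_grad (r i)))"
  proof (rule C0_norm_le)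
    fix s :: "real^'n" assume s: "norm s = 1"
    then have "s \<noteq> 0" by auto
    have *: "norm (c i *\<^sub>R surf_grad (r i) s) \<le> \<bar>c i\<bar> * C0_norm (surf_grad (r i))" for i
      using norm_le_C0_norm[OF cont(2) s, of i] by (simp add: mult_left_mono)
    show "norm (surf_grad F s) \<le> (\<Sum>i. \<bar>c i\<bar> * C0_norm (surf_grad (r i)))"
      using norm_suminf_le[OF * summ1] grad[OF \<open>s \<noteq> 0\<close>] by (simp add: G_def)
  qed
  ultimately show "C1_norm F \<le> (\<Sum>i. \<bar>c i\<bar> * C1_norm (r i))"
    using suminf_add[OF summ0 summ1] by (simp add: C1_norm_def distrib_left)
qed

section \<open>The modes are $C^1$\<close>

lemma C1_on_sphere_diff:
  assumes "C1_on_sphere r" "C1_on_sphere r'"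
  shows "C1_on_sphere (\<lambda>s. r s - r' s)"
  using C1_on_sphere_add[OF assms(1) C1_on_sphere_bounded_linear[OF bounded_linear_minus[OF bounded_linear_ident] assms(2)]]
  by simp

lemma C1_on_sphere_poly:
  assumes "C1_on_sphere r"
  shows "C1_on_sphere (\<lambda>s. poly p (r s) :: real)"
proof (induction p)
  case 0
  then show ?case by (simp add: C1_on_sphere_const)
next
  case (pCons a p)
  show ?case
    using C1_on_sphere_add[OF C1_on_sphere_const C1_on_sphere_mult[OF assms pCons.IH], of a] by simp
qed

lemma C1_on_sphere_complex_power:
  fixes i j :: "'n::finite"
  shows "C1_on_sphere (\<lambda>s::real^'n. Re (Complex (s $ i) (s $ j) ^ q)) \<and>
    C1_on_sphere (\<lambda>s::real^'n. Im (Complex (s $ i) (s $ j) ^ q))"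
  by (induction q)
     (auto intro!: C1_on_sphere_const C1_on_sphere_coord C1_on_sphere_add C1_on_sphere_diff C1_on_sphere_mult)

lemma power_eq_polar: "z ^ q = of_real (cmod z ^ q) * cis (real q * Arg2pi z)"
proof -
  have "z = of_real (cmod z) * cis (Arg2pi z)"
    using Arg2pi_eq[of z] by (simp add: cis_conv_exp)
  then have "z ^ q = (of_real (cmod z) * cis (Arg2pi z)) ^ q"
    by (rule arg_cong)
  also have "\<dots> = of_real (cmod z ^ q) * cis (real q * Arg2pi z)"
    unfolding power_mult_distrib Complex.DeMoivre of_real_power by (rule refl)
  finally show ?thesis .
qed

text \<open>
  On the unit circle $w = s_1 + i s_2$ has modulus 1, so $\cos(q\varphi)$ and $\sin(q\varphi)$ are the real
  and imaginary part of $w^q$.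
\<close>
lemma C1_on_sphere_circle_fun:
  fixes e :: "nat \<Rightarrow> 'n::finite"
  assumes "CARD('n) = 2" and e: "bij_betw e {1..CARD('n)} UNIV"
  shows "C1_on_sphere (circle_fun e j)"
proof -
  define w where "w s = Complex (s $ e 1) (s $ e 2)" for s :: "real^'n"
  have "circle_fun e j s = (if even j then Im (w s ^ (j div 2)) else Re (w s ^ (j div 2)))"
    if "norm s = 1" for s
  proof -
    have "(\<Sum>i\<in>UNIV. (s $ i)\<^sup>2) = 1"
      using that by (simp add: norm_vec_def L2_set_def)
    also have "(\<Sum>i\<in>UNIV. (s $ i)\<^sup>2) = (\<Sum>i\<in>{1..2}. (s $ e i)\<^sup>2)"
      using sum.reindex_bij_betw[OF e, of "\<lambda>i. (s $ i)\<^sup>2"] assms(1) by simp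
    also have "{1..2} = {1, 2::nat}" by auto
    finally have "cmod (w s) = 1"
      by (simp add: w_def cmod_def)
    then have "w s ^ (j div 2) = cis (real (j div 2) * Arg2pi (w s))"
      by (subst power_eq_polar) simp
    moreover have "real (j div 2) = (if even j then real j / 2 else (real j - 1) / 2)"
      by (auto elim!: evenE oddE)
    ultimately show ?thesis
      by (simp add: circle_fun_def azimuth_def w_def)
  qed
  then have "C1_on_sphere (circle_fun e j) =
      C1_on_sphere (\<lambda>s. if even j then Im (w s ^ (j div 2)) else Re (w s ^ (j div 2)))"
    by (rule C1_on_sphere_cong)
  then show ?thesis
    using C1_on_sphere_complex_power[of "e 1" "e 2" "j div 2"] by (cases "even j") (simp_all add: w_def)
qed

text \<open>
  On the sphere the factor $\sqrt{1 - s_3^2}^{\,q}$ of the associated Legendre function is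
  $|s_1 + i s_2|^q$, exactly the factor that turns $\cos(q\varphi)$ and $\sin(q\varphi)$ into polynomials.
\<close>
lemma C1_on_sphere_real_sph_harm:
  fixes e :: "nat \<Rightarrow> 'n::finite"
  assumes "CARD('n) = 3" and e: "bij_betw e {1..CARD('n)} UNIV"
  shows "C1_on_sphere (real_sph_harm e l m)"
proof -
  define w where "w s = Complex (s $ e 1) (s $ e 2)" for s :: "real^'n"
  define q where "q = nat \<bar>m\<bar>"
  define c where "c = sqrt ((2 * real l + 1) / (4 * pi) * (fact (l - q) / fact (l + q)))"
  define p where "p = (pderiv ^^ q) (legendre l)"
  define b :: real where "b = (if m = 0 then 1 else sqrt 2)"
  have "real_sph_harm e l m s
      = c * b * poly p (s $ e 3) * (if m \<ge> 0 then Re (w s ^ q) else Im (w s ^ q))"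
    if "norm s = 1" for s
  proof -
    have "(\<Sum>i\<in>UNIV. (s $ i)\<^sup>2) = 1"
      using that by (simp add: norm_vec_def L2_set_def)
    also have "(\<Sum>i\<in>UNIV. (s $ i)\<^sup>2) = (\<Sum>i\<in>{1..3}. (s $ e i)\<^sup>2)"
      using sum.reindex_bij_betw[OF e, of "\<lambda>i. (s $ i)\<^sup>2"] assms(1) by simp
    also have "{1..3} = {1, 2, 3::nat}" by auto
    finally have "1 - (s $ e 3)\<^sup>2 = (s $ e 1)\<^sup>2 + (s $ e 2)\<^sup>2"
      by simp
    then have "sqrt (1 - (s $ e 3)\<^sup>2) = cmod (w s)"
      by (simp add: w_def cmod_def)
    then show ?thesis
      unfolding power_eq_polar[of "w s" q]
      by (auto simp: real_sph_harm_def Let_def assoc_legendre_def azimuth_def w_def c_def b_def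
          p_def q_def)
  qed
  then have "C1_on_sphere (real_sph_harm e l m) = C1_on_sphere (\<lambda>s.
      c * b * poly p (s $ e 3) * (if m \<ge> 0 then Re (w s ^ q) else Im (w s ^ q)))"
    by (rule C1_on_sphere_cong)
  moreover have "C1_on_sphere (\<lambda>s. if m \<ge> 0 then Re (w s ^ q) else Im (w s ^ q))"
    using C1_on_sphere_complex_power[of "e 1" "e 2" q] by (cases "m \<ge> 0") (simp_all add: w_def)
  ultimately show ?thesis
    by (auto intro!: C1_on_sphere_mult C1_on_sphere_const C1_on_sphere_poly C1_on_sphere_coord)
qed

lemma shape_fun_C1:
  fixes e :: "nat \<Rightarrow> 'n::finite"
  assumes "CARD('n) = 2 \<or> CARD('n) = 3" and "bij_betw e {1..CARD('n)} UNIV"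
  shows "C1_on_sphere (shape_fun e j)"
proof (cases "CARD('n) = 2")
  case True
  then show ?thesis
    using C1_on_sphere_circle_fun[OF True assms(2)] by (simp add: shape_fun_def)
next
  case False
  then have "CARD('n) = 3"
    using assms(1) by blast
  from C1_on_sphere_mult[OF C1_on_sphere_real_sph_harm[OF this assms(2)] C1_on_sphere_const] False
  show ?thesis
    by (simp add: shape_fun_def sphere_fun_def Let_def divide_inverse)
qed

lemma shape_fun_le_1:
  fixes e :: "nat \<Rightarrow> 'n::finite"
  assumes "CARD('n) = 2 \<or> CARD('n) = 3" and "bij_betw e {1..CARD('n)} UNIV" and "norm s = 1"
  shows "\<bar>shape_fun e j s\<bar> \<le> 1"
proof (cases "CARD('n) = 2")
  case True
  then show ?thesis
    by (simp add: shape_fun_def circle_fun_def)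
next
  case False
  define l where "l = nat \<lfloor>sqrt (real j - 1)\<rfloor>"
  define Y where "Y = real_sph_harm e l (int j - 1 - (int l)\<^sup>2 - int l)"
  have "C1_on_sphere Y"
    unfolding Y_def using False assms(1,2) C1_on_sphere_real_sph_harm by blast
  then have "\<bar>Y s\<bar> \<le> C0_norm Y"
    using norm_le_C0_norm[OF continuous_on_sphere_if_C1 assms(3)] by fastforce
  moreover have "shape_fun e j s = Y s / C0_norm Y"
    using False by (simp add: shape_fun_def sphere_fun_def Let_def l_def Y_def)
  ultimately show ?thesis
    by (simp add: abs_divide divide_le_eq_1) linarith
qed

section \<open>The space of parameter sequences\<close>
lemma norm_le_linf_norm: "z \<in> linf \<Longrightarrow> norm (z i) \<le> linf_norm z"
  unfolding linf_def linf_norm_def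
  by (intro cSUP_upper bounded_imp_bdd_above) (auto simp: bounded_norm_comp)

lemma linf_norm_nonneg: "z \<in> linf \<Longrightarrow> 0 \<le> linf_norm z"
  using norm_le_linf_norm[of z 0] norm_ge_zero order_trans by blast

lemma linf_add: "g \<in> linf \<Longrightarrow> h \<in> linf \<Longrightarrow> g + h \<in> linf"
  by (simp add: linf_def bounded_plus_comp plus_fun_def)

section \<open>Component functions, nonnegative series and difference quotients\<close>
lemma C1_on_sphere_complexI:
  assumes "C1_on_sphere (\<lambda>s. Re (r s))" "C1_on_sphere (\<lambda>s. Im (r s))"
  shows "C1_on_sphere r"
proof -
  have "C1_on_sphere (\<lambda>s. of_real (Re (r s)) + \<i> * of_real (Im (r s)))"
    by (intro C1_on_sphere_add C1_on_sphere_bounded_linear[OF bounded_linear_of_real]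
        C1_on_sphere_bounded_linear[OF bounded_linear_mult_right] assms)
  then show ?thesis
    by (simp flip: complex_eq)
qed

lemma ennreal_suminf_leD:
  assumes "\<And>i. 0 \<le> a i" and "(\<Sum>i. ennreal (a i)) \<le> ennreal c" and "0 \<le> c"
  shows "summable a" and "(\<Sum>i. a i) \<le> c"
proof -
  show *: "summable a"
    using assms(2) by (intro summable_suminf_not_top assms(1)) (auto simp: top_unique)
  show "(\<Sum>i. a i) \<le> c"
    using assms(2) by (simp add: suminf_ennreal2[OF assms(1) *] ennreal_le_iff[OF assms(3)])
qed

text \<open>
  The mean value inequality on the ball of radius $1/2$ around \<open>x\<close>, where the gradient is at most
  twice its size on the sphere by homogeneity.
\<close>
lemma norm_diff_quotient_le:
  fixes r :: "real^'n::finite \<Rightarrow> 'b::real_normed_vector"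
  assumes r: "C1_on_sphere r" and x: "norm x = 1" and t: "0 < t" "t \<le> 1/2"
  shows "norm ((ray_ext r (x + t *\<^sub>R axis i 1) - ray_ext r x) /\<^sub>R t) \<le> 2 * CARD('n) * C1_norm r"
proof -
  define B where "B = 2 * real CARD('n) * C1_norm r"
  define S where "S = cball x (1/2)"
  have S: "1/2 \<le> norm y" "y \<noteq> 0" if "y \<in> S" for y
    using norm_triangle_ineq2[of x y] that x by (auto simp: S_def dist_norm)
  have "norm (ray_ext r (x + t *\<^sub>R axis i 1) - ray_ext r x) \<le> B * norm (x + t *\<^sub>R axis i 1 - x)"
  proof (rule differentiable_bound)
    show "convex S" "x + t *\<^sub>R axis i 1 \<in> S" "x \<in> S"
      using t by (auto simp: S_def dist_norm norm_axis_1)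
    fix y assume y: "y \<in> S"
    show "(ray_ext r has_derivative (\<lambda>h. \<Sum>i\<in>UNIV. h $ i *\<^sub>R surf_grad r y $ i)) (at y within S)"
      using has_derivative_ray_ext_coords[OF r S(2)[OF y]] by (rule has_derivative_at_withinI)
    have grad: "norm (surf_grad r y $ j) \<le> 2 * C1_norm r" for j
    proof -
      have "norm (surf_grad r y $ j) \<le> C1_norm r / norm y"
        using Finite_Cartesian_Product.norm_nth_le norm_surf_grad_le[OF r S(2)[OF y]] order_trans by blast
      also have "\<dots> \<le> C1_norm r / (1/2)"
        using C1_norm_nonneg[OF r] S[OF y] by (intro divide_left_mono mult_pos_pos) auto
      finally show ?thesis by simp
    qed
    show "onorm (\<lambda>h. \<Sum>i\<in>UNIV. h $ i *\<^sub>R surf_grad r y $ i) \<le> B"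
    proof (rule onorm_le)
      fix h :: "real^'n"
      have "norm (\<Sum>i\<in>UNIV. h $ i *\<^sub>R surf_grad r y $ i) \<le> (\<Sum>i\<in>(UNIV::'n set). norm h * (2 * C1_norm r))"
        by (intro sum_norm_le)
           (auto intro!: mult_mono grad component_le_norm_cart simp: C1_norm_nonneg[OF r])
      then show "norm (\<Sum>i\<in>UNIV. h $ i *\<^sub>R surf_grad r y $ i) \<le> B * norm h"
        by (simp add: B_def algebra_simps)
    qed
  qed
  then have "norm (ray_ext r (x + t *\<^sub>R axis i 1) - ray_ext r x) \<le> t * B"
    using t by (simp add: norm_axis_1 mult.commute)
  then have "inverse t * norm (ray_ext r (x + t *\<^sub>R axis i 1) - ray_ext r x) \<le> inverse t * (t * B)"
    using t by (intro mult_left_mono) auto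
  also have "inverse t * (t * B) = B"
    using t by simp
  finally show ?thesis
    unfolding norm_scaleR B_def using t by simp
qed

lemma norm_surf_grad_component_le:
  fixes r :: "real^'n::finite \<Rightarrow> 'b::real_normed_vector"
  assumes r: "C1_on_sphere r" and "x \<noteq> 0" and "0 < T"
    and quot: "\<And>t. 0 < t \<Longrightarrow> t \<le> T \<Longrightarrow>
      norm ((ray_ext r (x + t *\<^sub>R axis i 1) - ray_ext r x) /\<^sub>R t) \<le> M"
  shows "norm (surf_grad r x $ i) \<le> M"
proof (rule field_le_epsilon)
  fix \<epsilon> :: real assume "\<epsilon> > 0"
  define D where "D = frechet_derivative (ray_ext r) (at x)"
  have D: "(ray_ext r has_derivative D) (at x)"
    using has_derivative_ray_ext[OF assms(1,2)] by (simp add: D_def)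
  then obtain d where d: "d > 0" "\<And>y. norm (y - x) < d \<Longrightarrow>
      norm (ray_ext r y - ray_ext r x - D (y - x)) \<le> \<epsilon> * norm (y - x)"
    using \<open>\<epsilon> > 0\<close> unfolding has_derivative_at_alt by blast
  \<comment> \<open>A step short enough for the derivative estimate and admissible for the difference
    quotients.\<close>
  define t where "t = min (d / 2) T"
  have t: "0 < t" "t < d" "t \<le> T"
    using \<open>d > 0\<close> \<open>0 < T\<close> by (auto simp: t_def)
  define q where "q = ray_ext r (x + t *\<^sub>R axis i 1) - ray_ext r x"
  have "D (t *\<^sub>R axis i 1) = t *\<^sub>R surf_grad r x $ i"
    using surf_grad_eqI[OF D] linear_cmul[OF has_derivative_linear[OF D]] by simp
  then have "norm (q - t *\<^sub>R surf_grad r x $ i) \<le> \<epsilon> * t"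
    using d(2)[of "x + t *\<^sub>R axis i 1"] t by (simp add: q_def norm_axis_1)
  moreover have "norm q \<le> M * t"
  proof -
    have "norm q = norm (q /\<^sub>R t) * t"
      using t(1) by simp
    also have "\<dots> \<le> M * t"
      using quot[OF t(1,3)] t(1) unfolding q_def by (intro mult_right_mono) auto
    finally show ?thesis .
  qed
  moreover have "t * norm (surf_grad r x $ i) \<le> norm q + norm (q - t *\<^sub>R surf_grad r x $ i)"
    using norm_triangle_ineq4[of q "q - t *\<^sub>R surf_grad r x $ i"] t(1) by simp
  ultimately have "t * norm (surf_grad r x $ i) \<le> t * (M + \<epsilon>)"
    by (simp add: algebra_simps)
  then show "norm (surf_grad r x $ i) \<le> M + \<epsilon>"
    using t(1) by simp
qed

section \<open>The shape map\<close>
locale shape_parametrization =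
  fixes e :: "nat \<Rightarrow> 'n::finite" and \<beta> :: "nat \<Rightarrow> real" and k :: real
  assumes dim: "CARD('n) = 2 \<or> CARD('n) = 3"
    and labelling: "bij_betw e {1..CARD('n)} UNIV"
    and \<beta>_pos: "\<And>i. 0 < \<beta> i" and summable_\<beta>: "summable \<beta>"
    and k_pos: "0 < k"
begin

lemmas C1_modes = shape_fun_C1[OF dim labelling]
lemmas modes_le_1 = shape_fun_le_1[OF dim labelling]

lemma mode_term_le:
  fixes s :: "real^'n" and z :: "nat \<Rightarrow> complex"
  assumes "norm s = 1" and "\<And>i. norm (z i) \<le> B"
  shows "norm (of_real (\<beta> i) * z i * of_real (shape_fun e (Suc i) s)) \<le> B * \<beta> i"
proof -
  have "0 \<le> B"
    using assms(2)[of 0] norm_ge_zero order_trans by blast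
  then have "norm (of_real (\<beta> i) * z i * of_real (shape_fun e (Suc i) s)) \<le> \<beta> i * B * 1"
    unfolding norm_mult norm_of_real
    using \<beta>_pos[of i] assms modes_le_1[OF assms(1), of "Suc i"]
    by (intro mult_mono) auto
  then show ?thesis by (simp add: mult.commute)
qed

lemma shape_summable:
  assumes "z \<in> linf" and "norm s = 1"
  shows "summable (\<lambda>i. of_real (\<beta> i) * z i * of_real (shape_fun e (Suc i) s))"
  by (rule summable_comparison_test'[OF summable_mult[OF summable_\<beta>]])
     (rule mode_term_le[OF assms(2) norm_le_linf_norm[OF assms(1)]])

lemma shape_sums:
  assumes "z \<in> linf" and "norm s = 1"
  shows "(\<lambda>i. (1 / of_real k) * (of_real (\<beta> i) * z i * of_real (shape_fun e (Suc i) s))) sums shape e \<beta> k z s"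
  using sums_mult[OF summable_sums[OF shape_summable[OF assms]], of "1 / of_real k"] assms(2)
  by (simp add: shape_def)

lemma norm_shape_le:
  assumes "\<And>i. norm (z i) \<le> B"
  shows "norm (shape e \<beta> k z s) \<le> (\<Sum>i. \<beta> i) / k * B"
proof (cases "norm s = 1")
  case True
  have "norm (\<Sum>i. of_real (\<beta> i) * z i * of_real (shape_fun e (Suc i) s)) \<le> (\<Sum>i. B * \<beta> i)"
    by (rule norm_suminf_le[OF mode_term_le[OF True assms] summable_mult[OF summable_\<beta>]])
  then show ?thesis
    using True k_pos suminf_mult[OF summable_\<beta>, of B]
    by (simp add: shape_def norm_mult norm_divide divide_right_mono mult.commute)
next
  case False
  have "0 \<le> B"
    using assms[of 0] norm_ge_zero order_trans by blast
  moreover have "0 \<le> (\<Sum>i. \<beta> i)"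
    using \<beta>_pos summable_\<beta> by (intro suminf_nonneg) (auto simp: less_imp_le)
  ultimately show ?thesis
    using False k_pos by (simp add: shape_def)
qed

lemma shape_add:
  assumes "g \<in> linf" "h \<in> linf"
  shows "shape e \<beta> k (g + h) = shape e \<beta> k g + shape e \<beta> k h"
proof
  fix s :: "real^'n"
  show "shape e \<beta> k (g + h) s = (shape e \<beta> k g + shape e \<beta> k h) s"
  proof (cases "norm s = 1")
    case True
    show ?thesis
      using sums_unique2[OF shape_sums[OF linf_add[OF assms] True]
          sums_cong[THEN iffD1, OF _ sums_add[OF shape_sums[OF assms(1) True] shape_sums[OF assms(2) True]]]]
      by (simp add: algebra_simps)
  qed (simp add: shape_def)
qed

lemma shape_scale:
  assumes "h \<in> linf"
  shows "shape e \<beta> k (\<lambda>i. c * h i) = (\<lambda>s. c * shape e \<beta> k h s)"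
proof
  fix s :: "real^'n"
  show "shape e \<beta> k (\<lambda>i. c * h i) s = c * shape e \<beta> k h s"
  proof (cases "norm s = 1")
    case True
    show ?thesis
      using suminf_mult[OF shape_summable[OF assms True], of c] True
      by (simp add: shape_def mult.assoc mult.left_commute[of c])
  qed (simp add: shape_def)
qed

lemma param_set_subset_linf: "param_set e \<beta> C_Re C_Im k \<subseteq> linf"
  by (auto simp: param_set_def)

text \<open>
  Real and imaginary part of the shape function are real series of modes bounded by 1, and the
  three conditions on \<open>\<zeta>\<close> bound the sums that the triangle inequality produces for the three
  norms in \<open>analyticity_set\<close>.
\<close>
lemma shape_param_set:
  assumes \<zeta>: "\<zeta> \<in> param_set e \<beta> C_Re C_Im k" and C: "0 \<le> C_Re" "0 \<le> C_Im"
  shows "shape e \<beta> k \<zeta> \<in> analyticity_set k C_Re C_Im"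
proof -
  let ?r = "\<lambda>i. shape_fun e (Suc i)"
  have \<zeta>_linf: "\<zeta> \<in> linf"
    using \<zeta> by (simp add: param_set_def)
  have nonneg: "0 \<le> \<bar>\<beta> i\<bar> * \<bar>x\<bar> * C1_norm (?r i)" for i x
    using C1_norm_nonneg[OF C1_modes] by simp
  have bounds: "(\<Sum>i. ennreal (\<bar>\<beta> i\<bar> * \<bar>Re (\<zeta> i)\<bar>)) \<le> ennreal (k / 3)"
      "(\<Sum>i. ennreal (\<bar>\<beta> i\<bar> * \<bar>Re (\<zeta> i)\<bar> * C1_norm (?r i))) \<le> ennreal (k * C_Re)"
      "(\<Sum>i. ennreal (\<bar>\<beta> i\<bar> * \<bar>Im (\<zeta> i)\<bar> * C1_norm (?r i))) \<le> ennreal C_Im"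
    using \<zeta> by (auto simp: param_set_def)
  note C0 = ennreal_suminf_leD[OF _ bounds(1)]
  note Re = ennreal_suminf_leD[OF nonneg bounds(2)]
  note Im = ennreal_suminf_leD[OF nonneg bounds(3)]
  have sums_Re: "(\<lambda>i. (\<beta> i * Re (\<zeta> i) / k) * ?r i s) sums Re (shape e \<beta> k \<zeta> s)" if "norm s = 1" for s
    using sums_Re[OF shape_sums[OF \<zeta>_linf that]] by (simp add: Re_divide_of_real)
  have sums_Im: "(\<lambda>i. (\<beta> i * Im (\<zeta> i) / k) * ?r i s) sums Im (shape e \<beta> k \<zeta> s)" if "norm s = 1" for s
    using sums_Im[OF shape_sums[OF \<zeta>_linf that]] by (simp add: Im_divide_of_real)
  have eq: "\<bar>\<beta> i * x / k\<bar> * C1_norm (?r i) = \<bar>\<beta> i\<bar> * \<bar>x\<bar> * C1_norm (?r i) / k" for i x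
    using k_pos by (simp add: abs_mult)
  have summ_Re: "summable (\<lambda>i. \<bar>\<beta> i * Re (\<zeta> i) / k\<bar> * C1_norm (?r i))"
    unfolding eq using Re(1) k_pos C by (intro summable_divide) auto
  have summ_Im: "summable (\<lambda>i. \<bar>\<beta> i * Im (\<zeta> i) / k\<bar> * C1_norm (?r i))"
    unfolding eq using Im(1) C by (intro summable_divide) auto
  note series_Re = C1_on_sphere_series[OF C1_modes summ_Re sums_Re]
  note series_Im = C1_on_sphere_series[OF C1_modes summ_Im sums_Im]
  have "shape e \<beta> k \<zeta> \<in> C1_sphere"
    unfolding C1_sphere_eq using C1_on_sphere_complexI[OF series_Re(1) series_Im(1)] by simp
  moreover have "C0_norm (\<lambda>s. Re (shape e \<beta> k \<zeta> s)) \<le> 1/3"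
  proof (rule C0_norm_le)
    fix s :: "real^'n" assume s: "norm s = 1"
    have *: "norm ((\<beta> i * Re (\<zeta> i) / k) * ?r i s) \<le> \<bar>\<beta> i\<bar> * \<bar>Re (\<zeta> i)\<bar> / k" for i
      using modes_le_1[OF s, of "Suc i"] k_pos
      by (simp add: abs_mult divide_right_mono mult_left_le)
    have "norm (Re (shape e \<beta> k \<zeta> s)) \<le> (\<Sum>i. \<bar>\<beta> i\<bar> * \<bar>Re (\<zeta> i)\<bar> / k)"
      unfolding sums_unique[OF sums_Re[OF s]]
      using C0(1) k_pos by (intro norm_suminf_le * summable_divide) auto
    also have "\<dots> = (\<Sum>i. \<bar>\<beta> i\<bar> * \<bar>Re (\<zeta> i)\<bar>) / k"
      using C0(1) k_pos by (intro suminf_divide) auto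
    also have "\<dots> \<le> (k / 3) / k"
      using C0(2) k_pos by (intro divide_right_mono) auto
    finally show "norm (Re (shape e \<beta> k \<zeta> s)) \<le> 1/3"
      using k_pos by simp
  qed
  moreover have "C1_norm (\<lambda>s. Re (shape e \<beta> k \<zeta> s)) \<le> C_Re"
  proof -
    have "C1_norm (\<lambda>s. Re (shape e \<beta> k \<zeta> s)) \<le> (\<Sum>i. \<bar>\<beta> i\<bar> * \<bar>Re (\<zeta> i)\<bar> * C1_norm (?r i)) / k"
      using series_Re(2) suminf_divide[OF Re(1)] k_pos C unfolding eq by simp
    also have "\<dots> \<le> k * C_Re / k"
      using Re(2) k_pos C by (intro divide_right_mono) auto
    finally show ?thesis using k_pos by simp
  qed
  moreover have "k * C1_norm (\<lambda>s. Im (shape e \<beta> k \<zeta> s)) \<le> C_Im"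
  proof -
    have "C1_norm (\<lambda>s. Im (shape e \<beta> k \<zeta> s)) \<le> (\<Sum>i. \<bar>\<beta> i\<bar> * \<bar>Im (\<zeta> i)\<bar> * C1_norm (?r i)) / k"
      using series_Im(2) suminf_divide[OF Im(1)] C unfolding eq by simp
    also have "\<dots> \<le> C_Im / k"
      using Im(2) k_pos C by (intro divide_right_mono) auto
    finally show ?thesis using k_pos by (simp add: field_simps)
  qed
  ultimately show ?thesis
    by (simp add: analyticity_set_def)
qed

text \<open>
  The supremum norm of the shape function is always controlled by that of the sequence; its
  gradient is a limit of difference quotients, each bounded on $\ell^\infty$.  Their pointwise
  boundedness is the mean value inequality for the single function \<open>shape e \<beta> k z\<close>, and the uniform
  boundedness principle makes it uniform in \<open>z\<close>.
\<close>
lemma C1_norm_shape_bounded: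
  assumes dom: "shape_dom e \<beta> k = linf"
  obtains M where "M > 0" "\<And>h. h \<in> linf \<Longrightarrow> C1_norm (shape e \<beta> k h) \<le> M * linf_norm h"
proof -
  have C1: "C1_on_sphere (shape e \<beta> k z)" if "z \<in> linf" for z
    using that dom by (auto simp: shape_dom_def C1_sphere_eq)
  \<comment> \<open>The Banach space $\ell^\infty$ is realized as the bounded continuous functions on the discrete
    space of natural numbers.\<close>
  define seq where "seq z i = apply_bcontfun z (discrete i)" for z :: "nat discrete \<Rightarrow>\<^sub>C complex" and i
  have seq_linf: "seq z \<in> linf" for z
    using norm_bounded[of z] by (auto simp: linf_def seq_def intro!: boundedI)
  define E where "E x z = ray_ext (shape e \<beta> k (seq z)) x" for x z
  have E: "bounded_linear (E x)" for x
  proof (rule bounded_linear_intro)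
    fix y z :: "nat discrete \<Rightarrow>\<^sub>C complex"
    have "seq (y + z) = seq y + seq z"
      by (simp add: fun_eq_iff seq_def)
    then show "E x (y + z) = E x y + E x z"
      using shape_add[OF seq_linf seq_linf] by (simp add: E_def ray_ext_def)
    fix a :: real
    have "seq (a *\<^sub>R z) = (\<lambda>i. of_real a * seq z i)"
      by (simp add: fun_eq_iff seq_def scaleR_conv_of_real)
    then show "E x (a *\<^sub>R z) = a *\<^sub>R E x z"
      using shape_scale[OF seq_linf] by (simp add: E_def ray_ext_def scaleR_conv_of_real)
    have "norm (seq z i) \<le> norm z" for i
      unfolding seq_def by (rule norm_bounded)
    then show "norm (E x z) \<le> norm z * ((\<Sum>i. \<beta> i) / k)"
      using norm_shape_le[of "seq z"] by (simp add: E_def ray_ext_def mult.commute)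
  qed
  define T where "T = (\<lambda>(x :: real^'n, i, t) z. (E (x + t *\<^sub>R axis i 1) z - E x z) /\<^sub>R t)"
  define I where "I = {(x :: real^'n, i :: 'n, t :: real). norm x = 1 \<and> 0 < t \<and> t \<le> 1/2}"
  have "bounded_linear (T j)" for j
    unfolding T_def case_prod_beta
    by (intro bounded_linear_compose[OF bounded_linear_scaleR_right] bounded_linear_sub E)
  moreover have "\<exists>B. \<forall>j\<in>I. norm (T j z) \<le> B" for z
    unfolding T_def I_def E_def
    using norm_diff_quotient_le[OF C1[OF seq_linf[of z]]] by fastforce
  ultimately obtain M where M: "M > 0" "\<And>j z. j \<in> I \<Longrightarrow> norm (T j z) \<le> M * norm z"
    using uniform_boundedness[of I T] by blast
  \<comment> \<open>The first term bounds the function, the second its gradient; adding 1 makes the constant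
    positive.\<close>
  define N where "N = (\<Sum>i. \<beta> i) / k + real CARD('n) * M + 1"
  have "0 \<le> (\<Sum>i. \<beta> i) / k"
    using \<beta>_pos summable_\<beta> k_pos by (intro divide_nonneg_pos suminf_nonneg) (auto simp: less_imp_le)
  then have "N > 0"
    using M(1) by (simp add: N_def add_nonneg_pos)
  moreover have "C1_norm (shape e \<beta> k h) \<le> N * linf_norm h" if h: "h \<in> linf" for h
  proof -
    define z where "z = Bcontfun (\<lambda>n. h (of_discrete n))"
    have "(\<lambda>n. h (of_discrete n)) \<in> bcontfun"
      using h by (auto simp: linf_def bcontfun_def open_discrete continuous_on_open_vimage
          elim: bounded_subset)
    then have apply_z: "apply_bcontfun z n = h (of_discrete n)" for n
      by (simp add: z_def Bcontfun_inverse)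
    then have z: "seq z = h"
      by (simp add: seq_def fun_eq_iff discrete_inverse)
    have norm_z: "norm z \<le> linf_norm h"
      using norm_le_linf_norm[OF h] by (intro norm_bound) (simp add: apply_z)
    have "C0_norm (shape e \<beta> k h) \<le> (\<Sum>i. \<beta> i) / k * linf_norm h"
      by (intro C0_norm_le norm_shape_le norm_le_linf_norm h)
    moreover have "C0_norm (surf_grad (shape e \<beta> k h)) \<le> real CARD('n) * M * linf_norm h"
    proof (rule C0_norm_le)
      fix s :: "real^'n" assume s: "norm s = 1"
      then have "s \<noteq> 0" by auto
      have "norm (surf_grad (shape e \<beta> k h) s $ i) \<le> M * norm z" for i
      proof (rule norm_surf_grad_component_le[OF C1[OF h] \<open>s \<noteq> 0\<close>])
        fix t :: real assume "0 < t" "t \<le> 1/2"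
        then show "norm ((ray_ext (shape e \<beta> k h) (s + t *\<^sub>R axis i 1) - ray_ext (shape e \<beta> k h) s) /\<^sub>R t)
            \<le> M * norm z"
          using M(2)[of "(s, i, t)" z] s by (simp add: I_def T_def E_def z)
      qed simp
      then have "norm (surf_grad (shape e \<beta> k h) s $ i) \<le> M * linf_norm h" for i
        using norm_z M(1) order_trans mult_left_mono by (metis less_imp_le)
      then have "(\<Sum>i\<in>UNIV. norm (surf_grad (shape e \<beta> k h) s $ i)) \<le> real CARD('n) * (M * linf_norm h)"
        by (intro sum_bounded_above)
      moreover have "norm (surf_grad (shape e \<beta> k h) s) \<le> (\<Sum>i\<in>UNIV. norm (surf_grad (shape e \<beta> k h) s $ i))"
        unfolding norm_vec_def by (intro L2_set_le_sum) simp
      ultimately show "norm (surf_grad (shape e \<beta> k h) s) \<le> real CARD('n) * M * linf_norm h"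
        by simp
    qed
    ultimately show ?thesis
      using linf_norm_nonneg[OF h] by (simp add: C1_norm_def N_def distrib_right)
  qed
  ultimately show ?thesis
    using that by blast
qed

lemma holomorphic_near_shape:
  assumes hol: "holomorphic_near C1_sphere C1_norm Y nY D f (analyticity_set k C_Re C_Im)"
    and C: "0 \<le> C_Re" "0 \<le> C_Im"
    and X: "param_set e \<beta> C_Re C_Im k \<subseteq> X" "X \<subseteq> shape_dom e \<beta> k"
      "\<And>g h. g \<in> X \<Longrightarrow> h \<in> X \<Longrightarrow> g + h \<in> X"
    and "M > 0" "\<And>h. h \<in> X \<Longrightarrow> C1_norm (shape e \<beta> k h) \<le> M * nX h"
  shows "holomorphic_near X nX Y nY {z. shape e \<beta> k z \<in> D} (\<lambda>z. f (shape e \<beta> k z))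
      (param_set e \<beta> C_Re C_Im k)"
proof -
  have X': "h \<in> linf" "shape e \<beta> k h \<in> C1_sphere" if "h \<in> X" for h
    using X(2) that by (auto simp: shape_dom_def)
  show ?thesis
  proof (rule holomorphic_near_compose_linear[OF hol X(3) X'(2)])
    show "M > 0" by fact
    show "C1_norm (shape e \<beta> k h) \<le> M * nX h" if "h \<in> X" for h
      using assms(8) that by blast
    show "shape e \<beta> k ` param_set e \<beta> C_Re C_Im k \<subseteq> analyticity_set k C_Re C_Im"
      using shape_param_set[OF _ C] by blast
  qed (use X(1) C1_norm_nonneg in \<open>simp_all add: X' shape_add shape_scale C1_sphere_eq\<close>)
qed

lemma param_set_subset_shape_dom:
  assumes "0 \<le> C_Re" "0 \<le> C_Im"
  shows "param_set e \<beta> C_Re C_Im k \<subseteq> shape_dom e \<beta> k"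
  using shape_param_set[OF _ assms] param_set_subset_linf
  by (auto simp: shape_dom_def analyticity_set_def)

lemma shape_dom_add:
  assumes "g \<in> shape_dom e \<beta> k" "h \<in> shape_dom e \<beta> k"
  shows "g + h \<in> shape_dom e \<beta> k"
proof -
  have "g \<in> linf" "h \<in> linf" "C1_on_sphere (shape e \<beta> k g)" "C1_on_sphere (shape e \<beta> k h)"
    using assms by (auto simp: shape_dom_def C1_sphere_eq)
  moreover from this have "C1_on_sphere (shape e \<beta> k g + shape e \<beta> k h)"
    unfolding plus_fun_def by (intro C1_on_sphere_add)
  ultimately show ?thesis
    by (simp add: shape_dom_def C1_sphere_eq linf_add shape_add)
qed

end

section \<open>Holomorphy of the parametric solution map\<close>

theorem corollary7p4:
  fixes e :: "nat \<Rightarrow> 'n::finite"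
    and lam n_i C_Re C_Im k\<^sub>0 k :: real
    and chi :: "real \<Rightarrow> real"
    and \<beta> :: "nat \<Rightarrow> real"
    and L :: "(real^'n \<Rightarrow> complex) \<Rightarrow> complex"
  assumes "CARD('n) = 2 \<or> CARD('n) = 3"
    and "bij_betw e {1..CARD('n)} UNIV"
    and "0 < lam" and "lam < 1" and "radial_cutoff lam chi"
    and "0 < n_i" and "n_i < 1"
    and "C_Re \<ge> 2" and "C_Im > 0" and "k\<^sub>0 \<ge> 1/2"
    and constants: "\<forall>k'\<ge>k\<^sub>0. \<forall>L'\<in>H1_dual (ball 0 2 :: (real^'n) set).
           holomorphic_near C1_sphere C1_norm (H1 (ball 0 2)) (H1_norm (ball 0 2))
             (uniquely_solvable chi n_i k' L') (u_hat chi n_i k' L')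
             (analyticity_set k' C_Re C_Im)"
    and "\<forall>i. \<beta> i > 0" and "summable \<beta>" and "(\<Sum>i. \<beta> i) \<le> 1" and "1 \<le> k / 3"
    and "k \<ge> k\<^sub>0"
    and "L \<in> H1_dual (ball 0 2)"
  shows "(shape_dom e \<beta> k = linf \<longrightarrow>
         holomorphic_near linf linf_norm
           (H1 (ball 0 2)) (H1_norm (ball 0 2))
           {z. shape e \<beta> k z \<in> uniquely_solvable chi n_i k L}
           (\<lambda>z. u_hat chi n_i k L (shape e \<beta> k z))
           (param_set e \<beta> C_Re C_Im k))
       \<and> holomorphic_near (shape_dom e \<beta> k) (shape_norm e \<beta> k)
           (H1 (ball 0 2)) (H1_norm (ball 0 2))
           {z. shape e \<beta> k z \<in> uniquely_solvable chi n_i k L}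
           (\<lambda>z. u_hat chi n_i k L (shape e \<beta> k z))
           (param_set e \<beta> C_Re C_Im k)"
proof -
  interpret shape_parametrization e \<beta> k
    using assms by unfold_locales simp_all
  have hol: "holomorphic_near C1_sphere C1_norm (H1 (ball 0 2)) (H1_norm (ball 0 2))
      (uniquely_solvable chi n_i k L) (u_hat chi n_i k L) (analyticity_set k C_Re C_Im)"
    using constants \<open>k \<ge> k\<^sub>0\<close> \<open>L \<in> H1_dual (ball 0 2)\<close> by blast
  have C: "0 \<le> C_Re" "0 \<le> C_Im"
    using \<open>C_Re \<ge> 2\<close> \<open>C_Im > 0\<close> by auto
  note compose = holomorphic_near_shape[OF hol C]
  show ?thesis
  proof (intro conjI impI)
    assume dom: "shape_dom e \<beta> k = linf"
    obtain M where "M > 0" "\<And>h. h \<in> linf \<Longrightarrow> C1_norm (shape e \<beta> k h) \<le> M * linf_norm h"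
      using C1_norm_shape_bounded[OF dom] by blast
    then show "holomorphic_near linf linf_norm (H1 (ball 0 2)) (H1_norm (ball 0 2))
        {z. shape e \<beta> k z \<in> uniquely_solvable chi n_i k L}
        (\<lambda>z. u_hat chi n_i k L (shape e \<beta> k z)) (param_set e \<beta> C_Re C_Im k)"
      by (intro compose[where M=M] param_set_subset_linf linf_add) (simp_all add: dom)
  next
    have "C1_norm (shape e \<beta> k h) \<le> 1 * shape_norm e \<beta> k h" if "h \<in> shape_dom e \<beta> k" for h
      using that linf_norm_nonneg[of h] by (simp add: shape_norm_def shape_dom_def)
    then show "holomorphic_near (shape_dom e \<beta> k) (shape_norm e \<beta> k) (H1 (ball 0 2))
        (H1_norm (ball 0 2)) {z. shape e \<beta> k z \<in> uniquely_solvable chi n_i k L}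
        (\<lambda>z. u_hat chi n_i k L (shape e \<beta> k z)) (param_set e \<beta> C_Re C_Im k)"
      by (intro compose[where M=1] param_set_subset_shape_dom shape_dom_add C) simp_all
  qed
qed

end
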